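(* Let $\Sigma_A\subseteq\mathcal{A}^{\mathbb{N}}$ be a topologically mixing shift of finite type, let $\varphi:\Sigma_A\to\mathbb{R}$ be H\"older continuous, let $\mu_\varphi$ be the Gibbs state for $\varphi$, and let $\pi:\Sigma_A\to Y\subseteq\mathcal{B}^{\mathbb{N}}$ be a fiber-wise mixing $1$-block factor map. Then the projected measure $\pi_*\mu_\varphi$ is the Gibbs state for a H\"older continuous potential on $Y$.
   Context: $\mathcal{A},\mathcal{B}$ are finite alphabets and $\mathbb{N}=\{0,1,2,\dots\}$. $A$ is a $0$-$1$ matrix indexed by $\mathcal{A}$ and $\Sigma_A=\{x\in\mathcal{A}^{\mathbb{N}}: A_{x_kx_{k+1}}=1 \text{ for all } k\ge 0\}$ with the left shift $T$; every symbol of $\mathcal{A}$ is assumed to occur in $\Sigma_A$ (so topological mixing means that some power of $A$ has all entries positive). A map $\pi:\mathcal{A}\to\mathcal{B}$ induces a $1$-block factor map $\pi:\Sigma_A\to Y$, $\pi(x)_k=\pi(x_k)$, where $Y=\pi(\Sigma_A)\subseteq\mathcal{B}^{\mathbb{N}}$; $\pi$ is also applied to words letter by letter. A word is admissible in a shift space if it occurs in some point of that space. The $1$-block factor map $\pi$ is called fiber-wise mixing if there exists a positive integer $N$ such that for any word $b_0\cdots b_N$ admissible in $Y$ and any $a_0,a_N\in\mathcal{A}$ with $\pi(a_0)=b_0$ and $\pi(a_N)=b_N$, there exists a word $a_0a_1\cdots a_{N-1}a_N$ admissible in $\Sigma_A$ with $\pi(a_0\cdots a_N)=b_0\cdots b_N$.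 For a function $\psi$ on a one-sided shift space $X$, $\operatorname{var}_n(\psi)=\sup\{|\psi(x)-\psi(y)|: x,y\in X,\ x_i=y_i \text{ for } 0\le i\le n-1\}$; $\psi$ is H\"older continuous if there are $C\geq 0$ and $0<\theta<1$ with $\operatorname{var}_n(\psi)\le C\theta^n$ for all $n\ge 1$. A shift-invariant Borel probability measure $\mu$ on $X$ is the Gibbs state for $\psi$ if there are constants $C\ge1$ and $P\in\mathbb{R}$ such that $C^{-1}\le \mu([x_0\cdots x_{n-1}])/\exp(-Pn+\sum_{k=0}^{n-1}\psi(T^kx))\le C$ for all $x\in X$ and $n\ge1$, where $[x_0\cdots x_{n-1}]$ is the cylinder set of points of $X$ beginning with $x_0\cdots x_{n-1}$ and $T$ is the left shift. For H\"older $\varphi$ on a topologically mixing $\Sigma_A$ such a measure exists and is unique; it is denoted $\mu_\varphi$. The projected measure is $\pi_*\mu_\varphi(E)=\mu_\varphi(\pi^{-1}E)$. *)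

theory Defs
  imports "HOL-Probability.Probability"
begin

definition left_shift :: "(nat \<Rightarrow> 'a) \<Rightarrow> (nat \<Rightarrow> 'a)" where
  "left_shift x = (\<lambda>k. x (Suc k))"

definition SFT :: "nat ^ 'a ^ 'a \<Rightarrow> (nat \<Rightarrow> 'a) set" where
  "SFT A = {x. \<forall>k. A $ x k $ x (Suc k) = 1}"

definition zero_one_matrix :: "nat ^ 'a ^ 'a \<Rightarrow> bool" where
  "zero_one_matrix A \<longleftrightarrow> (\<forall>a b. A $ a $ b \<in> {0, 1})"

definition admissible_word :: "(nat \<Rightarrow> 'a) set \<Rightarrow> 'a list \<Rightarrow> bool" where
  "admissible_word X w \<longleftrightarrow> (\<exists>x\<in>X. \<exists>k. w = map x [k..<k + length w])"

text \<open>The alphabet carries the discrete topology, and a shift space the topology induced by the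
  product topology.\<close>

definition shift_topology :: "(nat \<Rightarrow> 'a) set \<Rightarrow> (nat \<Rightarrow> 'a) topology" where
  "shift_topology X = subtopology (product_topology (\<lambda>_. discrete_topology UNIV) UNIV) X"

definition shift_borel :: "(nat \<Rightarrow> 'a) set \<Rightarrow> (nat \<Rightarrow> 'a) measure" where
  "shift_borel X = sigma X {U. openin (shift_topology X) U}"

definition topologically_mixing :: "(nat \<Rightarrow> 'a) set \<Rightarrow> bool" where
  "topologically_mixing X \<longleftrightarrow>
    (\<forall>U V. openin (shift_topology X) U \<and> U \<noteq> {} \<and> openin (shift_topology X) V \<and> V \<noteq> {} \<longrightarrow>
      (\<exists>N. \<forall>n\<ge>N. U \<inter> (left_shift ^^ n) -` V \<noteq> {}))"

definition block_map :: "('a \<Rightarrow> 'b) \<Rightarrow> (nat \<Rightarrow> 'a) \<Rightarrow> (nat \<Rightarrow> 'b)" where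
  "block_map p x = (\<lambda>k. p (x k))"

definition fiberwise_mixing :: "(nat \<Rightarrow> 'a) set \<Rightarrow> ('a \<Rightarrow> 'b) \<Rightarrow> bool" where
  "fiberwise_mixing X p \<longleftrightarrow>
    (\<exists>N>0. \<forall>b. length b = N + 1 \<and> admissible_word (block_map p ` X) b \<longrightarrow>
      (\<forall>a\<^sub>0 a\<^sub>N. p a\<^sub>0 = b ! 0 \<and> p a\<^sub>N = b ! N \<longrightarrow>
        (\<exists>w. length w = N + 1 \<and> w ! 0 = a\<^sub>0 \<and> w ! N = a\<^sub>N \<and>
             admissible_word X w \<and> map p w = b)))"

text \<open>Potentials on \<open>X\<close> are represented by total functions; only their values on \<open>X\<close> are used.
  The variation is \<open>ennreal\<close>-valued, so that it is \<open>\<infinity>\<close> when the supremum is not finite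
  (on \<open>real\<close>, \<open>Sup\<close> of an unbounded set is unspecified).\<close>

definition variation :: "(nat \<Rightarrow> 'a) set \<Rightarrow> ((nat \<Rightarrow> 'a) \<Rightarrow> real) \<Rightarrow> nat \<Rightarrow> ennreal" where
  "variation X \<psi> n =
    (SUP (x, y) \<in> {(x, y). x \<in> X \<and> y \<in> X \<and> (\<forall>i<n. x i = y i)}. ennreal \<bar>\<psi> x - \<psi> y\<bar>)"

definition holder_potential :: "(nat \<Rightarrow> 'a) set \<Rightarrow> ((nat \<Rightarrow> 'a) \<Rightarrow> real) \<Rightarrow> bool" where
  "holder_potential X \<psi> \<longleftrightarrow>
    (\<exists>C \<theta>. 0 \<le> C \<and> 0 < \<theta> \<and> \<theta> < 1 \<and> (\<forall>n\<ge>1. variation X \<psi> n \<le> ennreal (C * \<theta> ^ n)))"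

definition cylinder :: "(nat \<Rightarrow> 'a) set \<Rightarrow> (nat \<Rightarrow> 'a) \<Rightarrow> nat \<Rightarrow> (nat \<Rightarrow> 'a) set" where
  "cylinder X x n = {y \<in> X. \<forall>i<n. y i = x i}"

definition invariant_prob_on :: "(nat \<Rightarrow> 'a) set \<Rightarrow> (nat \<Rightarrow> 'a) measure \<Rightarrow> bool" where
  "invariant_prob_on X \<mu> \<longleftrightarrow>
    prob_space \<mu> \<and> space \<mu> = X \<and> sets \<mu> = sets (shift_borel X) \<and>
    left_shift \<in> \<mu> \<rightarrow>\<^sub>M \<mu> \<and> distr \<mu> \<mu> left_shift = \<mu>"

definition gibbs_state ::
  "(nat \<Rightarrow> 'a) set \<Rightarrow> ((nat \<Rightarrow> 'a) \<Rightarrow> real) \<Rightarrow> (nat \<Rightarrow> 'a) measure \<Rightarrow> bool" where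
  "gibbs_state X \<psi> \<mu> \<longleftrightarrow> invariant_prob_on X \<mu> \<and>
    (\<exists>C\<ge>1. \<exists>P. \<forall>x\<in>X. \<forall>n\<ge>1.
      (let r = measure \<mu> (cylinder X x n) /
               exp (- P * real n + (\<Sum>k<n. \<psi> ((left_shift ^^ k) x)))
       in inverse C \<le> r \<and> r \<le> C))"

definition projected_measure ::
  "('a \<Rightarrow> 'b) \<Rightarrow> (nat \<Rightarrow> 'a) measure \<Rightarrow> (nat \<Rightarrow> 'b) measure" where
  "projected_measure p \<mu> = distr \<mu> (shift_borel (block_map p ` space \<mu>)) (block_map p)"

end

theory Submission
  imports Defs
begin

text \<open>For a word \<open>v\<close> over the factor alphabet let \<open>Z v f x\<close> be the sum of
  \<open>exp (S\<^sub>n \<phi> (a x)) f (a x)\<close> over the words \<open>a\<close> in the fiber of \<open>v\<close> for which \<open>a x\<close> is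
  admissible. The potential is \<open>\<psi> y = ln (lim\<^sub>n Z (y\<^sub>0 \<dots> y\<^sub>n) 1 / Z (y\<^sub>1 \<dots> y\<^sub>n) 1)\<close>, evaluated at
  any point over \<open>y\<^bsub>n+1\<^esub>\<close>. The quotient is a weighted average of the function \<open>Z y\<^sub>0 1\<close>, the weights
  being a Markov operator over \<open>y\<^sub>1 \<dots> y\<^sub>n\<close>; by fiber-wise mixing (a Doeblin condition on prefixes)
  and bounded distortion these operators contract a Lipschitz seminorm at a uniform exponential
  rate. Hence the limit exists and is Hoelder continuous.
  Birkhoff sums of \<open>\<psi>\<close> telescope: their exponential lies between the extreme values of
  \<open>Z (y\<^sub>0 \<dots> y\<^bsub>n-1\<^esub>) 1\<close>, and these are comparable to the projected measure of the cylinder by the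
  Gibbs property of \<open>\<mu>\<close> and fiber-wise mixing. The constant \<open>P\<close> is unchanged.\<close>

section \<open>Weighted averages\<close>

text \<open>A Doeblin minorization: the normalized weights satisfy \<open>r \<ge> d * r'\<close>
  with \<open>d = 1 / B\<^sup>2\<close>, one factor \<open>B\<close> coming from the pointwise
  comparison and one from the total masses. The common part \<open>d * r'\<close> cancels, and what
  is left on either side has mass \<open>1 - d\<close>.\<close>

lemma weighted_average_compare:
  fixes q q' f :: "'c \<Rightarrow> real"
  assumes fin: "finite S"
    and q0: "\<And>u. u \<in> S \<Longrightarrow> 0 \<le> q u" and q0': "\<And>u. u \<in> S \<Longrightarrow> 0 \<le> q' u"
    and le: "\<And>u. u \<in> S \<Longrightarrow> q u \<le> B * q' u" and le': "\<And>u. u \<in> S \<Longrightarrow> q' u \<le> B * q u"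
    and pos: "0 < sum q S" and B: "0 < B"
    and osc: "\<And>u u'. u \<in> S \<Longrightarrow> u' \<in> S \<Longrightarrow> \<bar>f u - f u'\<bar> \<le> c"
  shows "\<bar>(\<Sum>u\<in>S. q u * f u) / sum q S - (\<Sum>u\<in>S. q' u * f u) / sum q' S\<bar> \<le> (1 - 1 / B\<^sup>2) * c"
proof -
  have s1: "sum q S \<le> B * sum q' S"
    by (simp add: sum_distrib_left sum_mono le)
  with pos B have pos': "0 < sum q' S"
    by (smt (verit) zero_less_mult_pos)
  define r where "r u = q u / sum q S" for u
  define r' where "r' u = q' u / sum q' S" for u
  define d where "d = 1 / B\<^sup>2"
  define t where "t u = r u - d * r' u" for u
  have r1: "sum r S = 1" and r1': "sum r' S = 1"
    using pos pos' unfolding r_def r'_def by (simp_all flip: sum_divide_distrib)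
  have r0': "0 \<le> r' u" if "u \<in> S" for u
    using q0'[OF that] pos' by (simp add: r'_def)
  have t0: "0 \<le> t u" if "u \<in> S" for u
  proof -
    have "q' u * sum q S \<le> (B * q u) * (B * sum q' S)"
      using le'[OF that] s1 pos q0[OF that] B by (intro mult_mono) auto
    then have "r' u \<le> B\<^sup>2 * r u"
      using pos pos' by (simp add: r_def r'_def field_simps power2_eq_square)
    then show ?thesis
      using B by (simp add: t_def d_def field_simps)
  qed
  have t1: "sum t S = 1 - d"
    by (simp add: t_def sum_subtractf r1 r1' flip: sum_distrib_left)
  \<comment> \<open>Product coupling of the leftover \<open>t\<close>, of mass \<open>1 - d\<close>,
    with \<open>r'\<close>, of mass 1: only differences of values of \<open>f\<close> remain, so
    only \<open>c\<close> enters.\<close>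
  have *: "(\<Sum>u\<in>S. r u * f u) - (\<Sum>u\<in>S. r' u * f u) = (\<Sum>u\<in>S. \<Sum>u'\<in>S. t u * r' u' * (f u - f u'))"
  proof -
    have "(\<Sum>u\<in>S. \<Sum>u'\<in>S. t u * r' u' * (f u - f u'))
        = (\<Sum>u\<in>S. \<Sum>u'\<in>S. (t u * f u) * r' u') - (\<Sum>u\<in>S. \<Sum>u'\<in>S. t u * (r' u' * f u'))"
      by (simp add: algebra_simps sum_subtractf)
    also have "\<dots> = (\<Sum>u\<in>S. t u * f u) - (1 - d) * (\<Sum>u\<in>S. r' u * f u)"
      by (simp add: r1' t1 flip: sum_distrib_left sum_distrib_right)
    also have "(\<Sum>u\<in>S. t u * f u) = (\<Sum>u\<in>S. r u * f u) - d * (\<Sum>u\<in>S. r' u * f u)"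
      by (simp add: t_def left_diff_distrib sum_subtractf sum_distrib_left mult.assoc)
    finally show ?thesis by (simp add: algebra_simps)
  qed
  have "\<bar>\<Sum>u\<in>S. \<Sum>u'\<in>S. t u * r' u' * (f u - f u')\<bar> \<le> (\<Sum>u\<in>S. \<Sum>u'\<in>S. t u * r' u' * c)"
    using t0 r0' osc
    by (intro order_trans[OF sum_abs] sum_mono) (simp add: abs_mult mult_left_mono)
  also have "\<dots> = (1 - d) * c"
    by (simp add: r1' t1 mult.assoc flip: sum_distrib_left sum_distrib_right)
  finally show ?thesis
    unfolding *[symmetric] by (simp add: r_def r'_def d_def sum_divide_distrib)
qed

lemma weighted_average_close:
  fixes q f g :: "'c \<Rightarrow> real"
  assumes "\<And>u. u \<in> S \<Longrightarrow> 0 \<le> q u" "0 < sum q S" "\<And>u. u \<in> S \<Longrightarrow> \<bar>f u - g u\<bar> \<le> e"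
  shows "\<bar>(\<Sum>u\<in>S. q u * f u) / sum q S - (\<Sum>u\<in>S. q u * g u) / sum q S\<bar> \<le> e"
proof -
  have "\<bar>(\<Sum>u\<in>S. q u * f u) - (\<Sum>u\<in>S. q u * g u)\<bar> = \<bar>\<Sum>u\<in>S. q u * (f u - g u)\<bar>"
    by (simp add: algebra_simps sum_subtractf)
  also have "\<dots> \<le> (\<Sum>u\<in>S. q u * e)"
    using assms by (intro order_trans[OF sum_abs] sum_mono) (simp add: abs_mult mult_left_mono)
  also have "\<dots> = e * sum q S"
    by (simp add: sum_distrib_left mult.commute)
  finally show ?thesis
    using assms(2) by (simp add: diff_divide_distrib[symmetric] pos_divide_le_eq)
qed

section \<open>Words, Birkhoff sums and shift spaces\<close>

fun prepend :: "'a list \<Rightarrow> (nat \<Rightarrow> 'a) \<Rightarrow> nat \<Rightarrow> 'a" where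
  "prepend [] x = x"
| "prepend (a # w) x = case_nat a (prepend w x)"

fun weight :: "((nat \<Rightarrow> 'a) \<Rightarrow> real) \<Rightarrow> 'a list \<Rightarrow> (nat \<Rightarrow> 'a) \<Rightarrow> real" where
  "weight \<phi> [] x = 0"
| "weight \<phi> (a # w) x = \<phi> (prepend (a # w) x) + weight \<phi> w x"

lemma prepend_append: "prepend (u @ v) x = prepend u (prepend v x)"
  by (induction u) auto

lemma weight_append: "weight \<phi> (u @ v) x = weight \<phi> u (prepend v x) + weight \<phi> v x"
  by (induction u) (auto simp: prepend_append)

lemma prepend_0: "prepend a x 0 = hd (a @ [x 0])"
  by (cases a) auto

lemma prepend_nth: "prepend a x i = (if i < length a then a ! i else x (i - length a))"
  by (induction a arbitrary: i) (auto split: nat.split simp: nth_Cons)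

lemma left_shift_funpow: "(left_shift ^^ n) x = (\<lambda>k. x (n + k))"
  by (induction n) (auto simp: left_shift_def)

lemma prepend_map_left_shift: "prepend (map x [0..<n]) ((left_shift ^^ n) x) = x"
  by (auto simp: prepend_nth left_shift_funpow)

lemma weight_eq_birkhoff_sum:
  "weight \<phi> a x = (\<Sum>k<length a. \<phi> ((left_shift ^^ k) (prepend a x)))"
proof (induction a)
  case (Cons c a)
  have "left_shift (prepend (c # a) x) = prepend a x"
    by (simp add: left_shift_def)
  then show ?case
    using Cons by (simp add: sum.lessThan_Suc_shift funpow_swap1 del: sum.lessThan_Suc prepend.simps(2) funpow.simps(2))
      (simp add: funpow_Suc_right del: funpow.simps)
qed simp

lemma prepend_agree:
  assumes "\<And>i. i < k \<Longrightarrow> x i = x' i" "i < k + length a"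
  shows "prepend a x i = prepend a x' i"
  using assms(1)[of "i - length a"] assms(2) by (auto simp: prepend_nth)

text \<open>Beyond its membership, \<open>x\<close> enters only through \<open>x 0\<close>; hence
  points of the subshift with the same first symbol admit the same prefixes
  (\<open>W_cong\<close>).\<close>

lemma prepend_in_SFT_iff:
  "prepend a x \<in> SFT A \<longleftrightarrow> x \<in> SFT A \<and> successively (\<lambda>b c. A $ b $ c = 1) (a @ [x 0])"
proof (induction a)
  case (Cons c a)
  have "prepend (c # a) x \<in> SFT A \<longleftrightarrow> A $ c $ (prepend a x 0) = 1 \<and> prepend a x \<in> SFT A"
  proof -
    have "(\<forall>k. P k) \<longleftrightarrow> P 0 \<and> (\<forall>k. P (Suc k))" for P :: "nat \<Rightarrow> bool"
      by (metis not0_implies_Suc)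
    from this[of "\<lambda>k. A $ (prepend (c # a) x k) $ (prepend (c # a) x (Suc k)) = 1"] show ?thesis
      by (simp add: SFT_def)
  qed
  then show ?case
    using Cons by (auto simp: prepend_0 successively_Cons)
qed auto

lemma admissible_word_SFT_successively:
  assumes "admissible_word (SFT A) w"
  shows "successively (\<lambda>b c. A $ b $ c = 1) w"
proof -
  obtain x k where x: "x \<in> SFT A" "w = map x [k..<k + length w]"
    using assms unfolding admissible_word_def by blast
  have "successively (\<lambda>b c. A $ b $ c = 1) (map x [k..<k + n])" for n
  proof (induction n)
    case (Suc n)
    show ?case
    proof (cases n)
      case (Suc m)
      with Suc.IH x(1) show ?thesis
        by (simp add: successively_append_iff SFT_def)
    qed simp
  qed simp
  with x(2) show ?thesis by metis
qed

section \<open>Cylinders and measurability on shift spaces\<close>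

lemma openin_shift_cylinder: "openin (shift_topology X) {x \<in> X. \<forall>i<n. x i \<in> S i}"
proof -
  let ?P = "\<Pi>\<^sub>E i\<in>UNIV. if i < n then S i else UNIV"
  have "openin (product_topology (\<lambda>_. discrete_topology UNIV) UNIV) ?P"
    unfolding openin_PiE_gen
    by (rule disjI2, intro conjI finite_subset[OF _ finite_lessThan[of n]]) auto
  moreover have "{x \<in> X. \<forall>i<n. x i \<in> S i} = ?P \<inter> X"
    by (auto simp: PiE_iff split: if_splits)
  ultimately show ?thesis
    unfolding shift_topology_def openin_subtopology by blast
qed

lemma topspace_shift_topology: "topspace (shift_topology X) = X"
  by (simp add: shift_topology_def)

lemma space_shift_borel: "space (shift_borel X) = X"
  by (simp add: shift_borel_def space_measure_of_conv)

lemma sets_shift_borel: "sets (shift_borel X) = sigma_sets X {U. openin (shift_topology X) U}"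
proof -
  have "{U. openin (shift_topology X) U} \<subseteq> Pow X"
    using openin_subset topspace_shift_topology by blast
  then show ?thesis by (simp add: shift_borel_def)
qed

text \<open>Arbitrary sets \<open>S i\<close> cover both cylinders, with singletons, and preimages
  of cylinders under a block map, with fibers of \<open>p\<close>.\<close>

lemma sets_shift_cylinder: "{x \<in> X. \<forall>i<n. x i \<in> S i} \<in> sets (shift_borel X)"
  unfolding sets_shift_borel by (intro sigma_sets.Basic) (simp add: openin_shift_cylinder)

lemma measurable_shift_borel:
  assumes "continuous_map (shift_topology X) (shift_topology Y) f"
  shows "f \<in> shift_borel X \<rightarrow>\<^sub>M shift_borel Y"
  unfolding shift_borel_def[of Y]
proof (rule measurable_measure_of)
  show "{U. openin (shift_topology Y) U} \<subseteq> Pow Y"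
    using openin_subset topspace_shift_topology by blast
  show "f \<in> space (shift_borel X) \<rightarrow> Y"
    using assms unfolding continuous_map_def space_shift_borel topspace_shift_topology by blast
  fix V assume "V \<in> {U. openin (shift_topology Y) U}"
  then have "openin (shift_topology X) {x \<in> X. f x \<in> V}"
    using assms unfolding continuous_map_def topspace_shift_topology by blast
  moreover have "f -` V \<inter> space (shift_borel X) = {x \<in> X. f x \<in> V}"
    by (auto simp: space_shift_borel)
  ultimately show "f -` V \<inter> space (shift_borel X) \<in> sets (shift_borel X)"
    unfolding sets_shift_borel by (intro sigma_sets.Basic) simp
qed

lemma continuous_map_shift_topology:
  assumes "f ` X \<subseteq> Y" "\<And>k. \<exists>j g. \<forall>x. f x k = g (x j)"
  shows "continuous_map (shift_topology X) (shift_topology Y) f"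
proof -
  have "continuous_map (product_topology (\<lambda>_. discrete_topology UNIV) UNIV)
      (product_topology (\<lambda>_. discrete_topology UNIV) UNIV) f"
    unfolding continuous_map_componentwise_UNIV
  proof
    fix k
    obtain j g where g: "\<And>x. f x k = g (x j)" using assms(2) by blast
    have "continuous_map (product_topology (\<lambda>_. discrete_topology UNIV) UNIV) (discrete_topology UNIV) (g \<circ> (\<lambda>x. x j))"
      by (rule continuous_map_compose[of _ "discrete_topology UNIV"])
        (auto intro: continuous_map_product_projection[of j UNIV "\<lambda>_. discrete_topology UNIV"])
    then show "continuous_map (product_topology (\<lambda>_. discrete_topology UNIV) UNIV) (discrete_topology UNIV) (\<lambda>x. f x k)"
      by (simp add: g comp_def)
  qed
  then show ?thesis
    unfolding shift_topology_def using assms(1)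
    by (intro continuous_map_into_subtopology continuous_map_from_subtopology) auto
qed

section \<open>Projection of invariant measures\<close>

lemma left_shift_block_map: "left_shift (block_map p x) = block_map p (left_shift x)"
  by (simp add: left_shift_def block_map_def)

lemma block_map_measurable:
  assumes "invariant_prob_on X \<mu>"
  shows "block_map p \<in> \<mu> \<rightarrow>\<^sub>M shift_borel (block_map p ` X)"
proof -
  have "continuous_map (shift_topology X) (shift_topology (block_map p ` X)) (block_map p)"
    by (rule continuous_map_shift_topology) (auto simp: block_map_def)
  then have "block_map p \<in> shift_borel X \<rightarrow>\<^sub>M shift_borel (block_map p ` X)"
    by (rule measurable_shift_borel)
  moreover have "sets \<mu> = sets (shift_borel X)" using assms by (simp add: invariant_prob_on_def)
  ultimately show ?thesis using measurable_cong_sets by blast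
qed

lemma invariant_projected_measure:
  assumes inv: "invariant_prob_on X \<mu>"
  shows "invariant_prob_on (block_map p ` X) (projected_measure p \<mu>)"
proof -
  let ?Y = "block_map p ` X" and ?\<nu> = "projected_measure p \<mu>"
  have X: "prob_space \<mu>" "space \<mu> = X" "left_shift \<in> \<mu> \<rightarrow>\<^sub>M \<mu>" "distr \<mu> \<mu> left_shift = \<mu>"
    using inv by (auto simp: invariant_prob_on_def)
  note bm = block_map_measurable[OF inv, of p]
  have \<nu>: "?\<nu> = distr \<mu> (shift_borel ?Y) (block_map p)"
    by (simp add: projected_measure_def X)
  have "left_shift x \<in> X" if "x \<in> X" for x
    using measurable_space[OF X(3)] that X(2) by auto
  then have "continuous_map (shift_topology ?Y) (shift_topology ?Y) left_shift"
  proof (intro continuous_map_shift_topology)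
    show "left_shift ` ?Y \<subseteq> ?Y"
      using \<open>\<And>x. x \<in> X \<Longrightarrow> left_shift x \<in> X\<close> by (auto simp: left_shift_block_map)
  qed (auto simp: left_shift_def)
  then have ls: "left_shift \<in> shift_borel ?Y \<rightarrow>\<^sub>M shift_borel ?Y"
    by (rule measurable_shift_borel)
  have "distr ?\<nu> ?\<nu> left_shift = distr ?\<nu> (shift_borel ?Y) left_shift"
    by (intro distr_cong) (auto simp: \<nu>)
  also have "\<dots> = distr \<mu> (shift_borel ?Y) (left_shift \<circ> block_map p)"
    unfolding \<nu> by (rule distr_distr[OF ls bm])
  also have "left_shift \<circ> block_map p = block_map p \<circ> left_shift"
    by (auto simp: left_shift_block_map)
  also have "distr \<mu> (shift_borel ?Y) (block_map p \<circ> left_shift) = distr (distr \<mu> \<mu> left_shift) (shift_borel ?Y) (block_map p)"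
    by (rule distr_distr[OF bm X(3), symmetric])
  also have "\<dots> = ?\<nu>" by (simp add: X(4) \<nu>)
  finally have "distr ?\<nu> ?\<nu> left_shift = ?\<nu>" .
  moreover have "left_shift \<in> ?\<nu> \<rightarrow>\<^sub>M ?\<nu>"
    using ls measurable_cong_sets[of ?\<nu> "shift_borel ?Y" ?\<nu> "shift_borel ?Y"] by (simp add: \<nu>)
  ultimately show ?thesis
    unfolding invariant_prob_on_def
    using prob_space.prob_space_distr[OF X(1) bm] by (simp add: \<nu> space_shift_borel)
qed

lemma projected_measure_cylinder:
  assumes inv: "invariant_prob_on X \<mu>"
  shows "measure (projected_measure p \<mu>) (cylinder (block_map p ` X) (block_map p x) n)
    = measure \<mu> {t \<in> X. \<forall>i<n. p (t i) = p (x i)}"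
proof -
  let ?Y = "block_map p ` X"
  have X: "space \<mu> = X" using inv by (auto simp: invariant_prob_on_def)
  have "cylinder ?Y (block_map p x) n = {y \<in> ?Y. \<forall>i<n. y i \<in> {p (x i)}}"
    by (auto simp: cylinder_def block_map_def)
  then have "cylinder ?Y (block_map p x) n \<in> sets (shift_borel ?Y)"
    by (simp only: sets_shift_cylinder)
  then have "measure (projected_measure p \<mu>) (cylinder ?Y (block_map p x) n)
      = measure \<mu> (block_map p -` cylinder ?Y (block_map p x) n \<inter> X)"
    using measure_distr[OF block_map_measurable[OF inv]] by (simp add: projected_measure_def X)
  also have "block_map p -` cylinder ?Y (block_map p x) n \<inter> X = {t \<in> X. \<forall>i<n. p (t i) = p (x i)}"
    by (auto simp: cylinder_def block_map_def)
  finally show ?thesis .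
qed

text \<open>The cylinder of \<open>prepend a x\<close> depends on \<open>a\<close> alone, so the
  base point \<open>x\<close> is free in the Gibbs inequality. This allows weights over one fixed
  base point to be compared with measures of cylinders.\<close>

lemma gibbs_state_weight:
  assumes X: "prepend a x \<in> X" "a \<noteq> []"
    and gibbs: "\<forall>x\<in>X. \<forall>n\<ge>1. (let r = measure \<mu> (cylinder X x n) /
        exp (- P * real n + (\<Sum>k<n. \<phi> ((left_shift ^^ k) x))) in inverse C \<le> r \<and> r \<le> C)"
    and C: "1 \<le> C"
  shows "exp (weight \<phi> a x) \<le> C * exp (P * real (length a)) * measure \<mu> {y \<in> X. \<forall>i<length a. y i = a ! i}"
    "measure \<mu> {y \<in> X. \<forall>i<length a. y i = a ! i} \<le> C * exp (- (P * real (length a))) * exp (weight \<phi> a x)"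
proof -
  let ?m = "measure \<mu> {y \<in> X. \<forall>i<length a. y i = a ! i}"
  let ?e = "exp (- (P * real (length a)) + weight \<phi> a x)"
  have "cylinder X (prepend a x) (length a) = {y \<in> X. \<forall>i<length a. y i = a ! i}"
    by (auto simp: cylinder_def prepend_nth)
  moreover have "1 \<le> length a" using X(2) by (cases a) auto
  ultimately have "inverse C \<le> ?m / ?e \<and> ?m / ?e \<le> C"
    using bspec[OF gibbs X(1), THEN spec, of "length a"] by (simp add: weight_eq_birkhoff_sum Let_def)
  then have "?e \<le> C * ?m" "?m \<le> C * ?e"
    using C by (simp_all add: field_simps)
  then show "exp (weight \<phi> a x) \<le> C * exp (P * real (length a)) * ?m"
    "?m \<le> C * exp (- (P * real (length a))) * exp (weight \<phi> a x)"
    by (simp_all add: exp_diff exp_minus field_simps)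
qed

section \<open>Fiber operators\<close>

text \<open>\<open>bounded\<close> and \<open>holder\<close> carry the quantitative content of
  Hoelder continuity, with \<open>k > 0\<close> because variations are controlled from index 1 on.
  \<open>predecessor\<close> comes from topological mixing and serves to lengthen words to the left
  before fiber-wise mixing is applied.\<close>

locale fiber_mixing_system =
  fixes A :: "nat ^ 'a::finite ^ 'a" and p :: "'a \<Rightarrow> 'b"
    and \<phi> :: "(nat \<Rightarrow> 'a) \<Rightarrow> real" and s H \<theta> :: real and N :: nat
  assumes bounded: "x \<in> SFT A \<Longrightarrow> \<bar>\<phi> x\<bar> \<le> s"
    and holder: "x \<in> SFT A \<Longrightarrow> x' \<in> SFT A \<Longrightarrow> 0 < k \<Longrightarrow> (\<And>i. i < k \<Longrightarrow> x i = x' i)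
      \<Longrightarrow> \<bar>\<phi> x - \<phi> x'\<bar> \<le> H * \<theta> ^ k"
    and H0: "0 \<le> H" and theta0: "0 < \<theta>" and theta1: "\<theta> < 1" and N0: "0 < N"
    and fiber: "\<And>b a a'. length b = N + 1 \<Longrightarrow> admissible_word (block_map p ` SFT A) b \<Longrightarrow>
      p a = b ! 0 \<Longrightarrow> p a' = b ! N \<Longrightarrow>
      \<exists>w. length w = N + 1 \<and> w ! 0 = a \<and> w ! N = a' \<and> admissible_word (SFT A) w \<and> map p w = b"
    and predecessor: "x \<in> SFT A \<Longrightarrow> \<exists>a. prepend [a] x \<in> SFT A"
begin

definition W :: "'b list \<Rightarrow> (nat \<Rightarrow> 'a) \<Rightarrow> 'a list set" where
  "W v x = {a. map p a = v \<and> prepend a x \<in> SFT A}"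

text \<open>The iterate of order \<open>length v\<close> of Ruelle's transfer operator, restricted
  to the inverse branches over \<open>v\<close>; summing over all \<open>v\<close> of that length
  gives the full iterate.\<close>

definition Z :: "'b list \<Rightarrow> ((nat \<Rightarrow> 'a) \<Rightarrow> real) \<Rightarrow> (nat \<Rightarrow> 'a) \<Rightarrow> real" where
  "Z v f x = (\<Sum>a\<in>W v x. exp (weight \<phi> a x) * f (prepend a x))"

definition D :: "'b \<Rightarrow> (nat \<Rightarrow> 'a) set" where
  "D b = {x \<in> SFT A. p (x 0) = b}"

text \<open>Encodes admissibility of \<open>v @ [b]\<close> in the factor. One base point over
  \<open>b\<close> suffices here; by \<open>W_nonempty\<close> every other one then works
  too.\<close>

definition follows :: "'b list \<Rightarrow> 'b \<Rightarrow> bool" where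
  "follows v b \<longleftrightarrow> (\<exists>t\<in>D b. W v t \<noteq> {})"

definition C1 :: real where "C1 = H / (1 - \<theta>)"

lemma C1_nonneg: "0 \<le> C1"
  using H0 theta1 by (simp add: C1_def)

lemma s_nonneg: "x \<in> SFT A \<Longrightarrow> 0 \<le> s"
  using bounded[of x] by linarith

lemma theta_power_le_1: "\<theta> ^ k \<le> 1"
  using theta0 theta1 by (simp add: power_le_one)

lemma weight_bound: "prepend a x \<in> SFT A \<Longrightarrow> \<bar>weight \<phi> a x\<bar> \<le> s * real (length a)"
proof (induction a)
  case (Cons c a)
  then have "prepend a x \<in> SFT A"
    using prepend_in_SFT_iff[of "c # a"] prepend_in_SFT_iff[of a]
    by (auto simp: successively_Cons)
  with Cons.IH bounded[OF Cons.prems] show ?case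
    by (simp add: algebra_simps)
qed simp

lemma weight_distortion:
  assumes "prepend a x \<in> SFT A" "prepend a x' \<in> SFT A" "\<And>i. i < k \<Longrightarrow> x i = x' i"
  shows "\<bar>weight \<phi> a x - weight \<phi> a x'\<bar> \<le> C1 * \<theta> ^ k"
proof -
  \<comment> \<open>The factor \<open>1 - \<theta> ^ length a\<close> turns the bound into a partial
    sum of the geometric series with limit \<open>C1 * \<theta> ^ k\<close>, which lets the
    induction close.\<close>
  have "\<bar>weight \<phi> a x - weight \<phi> a x'\<bar> \<le> C1 * \<theta> ^ k * (1 - \<theta> ^ length a)"
    using assms(1,2)
  proof (induction a)
    case (Cons c a)
    then have X: "prepend a x \<in> SFT A" "prepend a x' \<in> SFT A"
      using prepend_in_SFT_iff[of "c # a"] prepend_in_SFT_iff[of a]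
      by (auto simp: successively_Cons)
    have "\<bar>\<phi> (prepend (c # a) x) - \<phi> (prepend (c # a) x')\<bar> \<le> H * \<theta> ^ (k + length (c # a))"
      using Cons.prems prepend_agree[OF assms(3)] by (intro holder) (auto simp del: prepend.simps)
    also have "\<dots> \<le> H * \<theta> ^ (k + length a)"
      using H0 theta0 theta1 by (intro mult_left_mono power_decreasing) auto
    also have "\<dots> = C1 * \<theta> ^ k * (\<theta> ^ length a - \<theta> ^ length (c # a))"
      using theta1 by (simp add: C1_def power_add field_simps)
    finally show ?case
      using Cons.IH[OF X] by (simp add: algebra_simps)
  qed simp
  also have "\<dots> \<le> C1 * \<theta> ^ k"
    using C1_nonneg theta0 by (simp add: mult_left_le)
  finally show ?thesis .
qed

lemma finite_W: "finite (W v x)"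
proof (rule finite_subset)
  show "W v x \<subseteq> {a. set a \<subseteq> UNIV \<and> length a = length v}"
    by (auto simp: W_def)
qed (rule finite_lists_length_eq, simp)

lemma W_cong: "x \<in> SFT A \<Longrightarrow> x' \<in> SFT A \<Longrightarrow> x 0 = x' 0 \<Longrightarrow> W v x = W v x'"
  by (auto simp: W_def prepend_in_SFT_iff)

lemma W_Nil: "x \<in> SFT A \<Longrightarrow> W [] x = {[]}"
  by (auto simp: W_def)

lemma Z_Nil: "x \<in> SFT A \<Longrightarrow> Z [] f x = f x"
  by (simp add: Z_def W_Nil)

text \<open>A lift of \<open>u @ v\<close> splits uniquely into a lift of \<open>v\<close> over
  \<open>x\<close> and a lift of \<open>u\<close> over the resulting point, and weights add up by
  \<open>weight_append\<close>. The word next to the base point acts last.\<close>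

lemma Z_append: "Z (u @ v) f x = Z v (Z u f) x"
proof -
  have "Z (u @ v) f x = (\<Sum>(b, a)\<in>Sigma (W v x) (\<lambda>b. W u (prepend b x)).
      exp (weight \<phi> (a @ b) x) * f (prepend (a @ b) x))"
    unfolding Z_def
  proof (rule sum.reindex_bij_witness[where i = "\<lambda>(b, a). a @ b" and j = "\<lambda>c. (drop (length u) c, take (length u) c)"])
    fix c assume c: "c \<in> W (u @ v) x"
    then have "map p (take (length u) c) = u" "map p (drop (length u) c) = v"
      by (auto simp: W_def take_map[symmetric] drop_map[symmetric])
    moreover have "prepend (take (length u) c) (prepend (drop (length u) c) x) \<in> SFT A"
      using c by (simp add: W_def flip: prepend_append)
    ultimately show "(drop (length u) c, take (length u) c) \<in> Sigma (W v x) (\<lambda>b. W u (prepend b x))"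
      by (auto simp: W_def prepend_in_SFT_iff[of "take _ _"])
  qed (auto simp: W_def simp flip: prepend_append)
  also have "\<dots> = (\<Sum>b\<in>W v x. \<Sum>a\<in>W u (prepend b x). exp (weight \<phi> (a @ b) x) * f (prepend (a @ b) x))"
    by (rule sum.Sigma[symmetric]) (auto simp: finite_W)
  also have "\<dots> = Z v (Z u f) x"
    unfolding Z_def by (simp add: weight_append prepend_append exp_add sum_distrib_left algebra_simps)
  finally show ?thesis .
qed

lemma prepend_in_D: "a \<in> W v x \<Longrightarrow> x \<in> D b \<Longrightarrow> prepend a x \<in> D (hd (v @ [b]))"
  by (cases a) (auto simp: W_def D_def prepend_0)

lemma follows_append:
  assumes "follows (u @ v) b"
  shows "follows u (hd (v @ [b]))" "follows v b"
proof -
  obtain t a where t: "t \<in> D b" "map p a = u @ v" "prepend a t \<in> SFT A"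
    using assms by (auto simp: follows_def W_def)
  then obtain a1 a2 where a: "a = a1 @ a2" "map p a1 = u" "map p a2 = v"
    by (auto simp: map_eq_append_conv)
  have X: "prepend a1 (prepend a2 t) \<in> SFT A"
    using t(3) by (simp add: a prepend_append)
  then have a2: "a2 \<in> W v t"
    using a by (auto simp: W_def prepend_in_SFT_iff[of a1])
  with t(1) show "follows v b" by (auto simp: follows_def)
  show "follows u (hd (v @ [b]))"
    using prepend_in_D[OF a2 t(1)] X a by (auto simp: follows_def W_def)
qed

text \<open>The form in which fiber-wise mixing is used: a lift \<open>u\<close> of a prefix that
  leaves \<open>N - 1\<close> letters extends to a lift of the whole word over any prescribed base
  point. The mixing word runs from \<open>last u\<close> to \<open>x 0\<close> across these letters;
  dropping both its ends gives \<open>a\<close>.\<close>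

lemma connect:
  assumes f: "follows (map p u @ v) b" and u: "u \<noteq> []" "prepend u z \<in> SFT A"
    and v: "length v + 1 = N" and x: "x \<in> D b"
  obtains a where "u @ a \<in> W (map p u @ v) x"
proof -
  obtain t c where t: "t \<in> D b" "map p c = map p u @ v" "prepend c t \<in> SFT A"
    using f by (auto simp: follows_def W_def)
  define w where "w = p (last u) # v @ [b]"
  have len: "length c = length u + length v"
    using arg_cong[OF t(2), of length] by simp
  have cp: "p (c ! i) = (map p u @ v) ! i" if "i < length u + length v" for i
    using that len t(2) by (metis nth_map)
  have "w ! i = p (prepend c t (length u - 1 + i))" if i: "i < length w" for i
  proof -
    consider "i = 0" | j where "i = Suc j" "j < length v" | "i = Suc (length v)"
      using i by (cases i) (auto simp: w_def less_Suc_eq)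
    then show ?thesis
    proof cases
      case 1
      then show ?thesis
        using u(1) len cp[of "length u - 1"]
        by (cases u rule: rev_cases) (auto simp: w_def prepend_nth nth_append)
    next
      case 2
      then show ?thesis
        using u(1) len cp[of "length u + j"]
        by (cases u) (auto simp: w_def prepend_nth nth_append)
    next
      case 3
      then show ?thesis
        using u(1) len t(1)
        by (cases u) (auto simp: w_def prepend_nth nth_append D_def)
    qed
  qed
  then have "w = map (block_map p (prepend c t)) [length u - 1..<length u - 1 + length w]"
    by (intro nth_equalityI) (auto simp: block_map_def)
  then have "admissible_word (block_map p ` SFT A) w"
    unfolding admissible_word_def using t(3) by blast
  moreover have "length w = N + 1" using v by (simp add: w_def)
  moreover have "p (last u) = w ! 0" by (simp add: w_def)
  moreover have "p (x 0) = w ! N" using x v by (auto simp: w_def D_def nth_append nth_Cons')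
  ultimately obtain w' where w': "length w' = N + 1" "w' ! 0 = last u" "w' ! N = x 0"
      "admissible_word (SFT A) w'" "map p w' = w"
    using fiber by blast
  define a where "a = butlast (tl w')"
  have "w' = hd w' # a @ [last (tl w')]"
    using w'(1) N0 by (cases w') (auto simp: a_def)
  moreover have "hd w' = last u" using w'(1,2) by (cases w') auto
  moreover have "last (tl w') = x 0"
    using w'(1,3) N0 by (cases w') (auto simp: last_conv_nth)
  ultimately have eq: "w' = last u # a @ [x 0]" by simp
  have suc: "successively (\<lambda>b c. A $ b $ c = 1) ([last u] @ (a @ [x 0]))"
    using admissible_word_SFT_successively[OF w'(4)] eq by simp
  have "successively (\<lambda>b c. A $ b $ c = 1) u"
    using u(2) unfolding prepend_in_SFT_iff successively_append_iff by blast
  then have "successively (\<lambda>b c. A $ b $ c = 1) (u @ (a @ [x 0]))"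
    using suc u(1) unfolding successively_append_iff[of _ u] successively_append_iff[of _ "[last u]"]
    by auto
  then have "prepend (u @ a) x \<in> SFT A"
    using x by (simp add: prepend_in_SFT_iff D_def)
  moreover have "map p (u @ a) = map p u @ v"
    using w'(5) eq by (simp add: w_def)
  ultimately show ?thesis
    using that by (auto simp: W_def)
qed

lemma prepend_word_exists: "x \<in> SFT A \<Longrightarrow> \<exists>e. length e = n \<and> prepend e x \<in> SFT A"
proof (induction n)
  case (Suc n)
  then obtain e where e: "length e = n" "prepend e x \<in> SFT A" by blast
  obtain c where "prepend [c] (prepend e x) \<in> SFT A"
    using predecessor[OF e(2)] by blast
  with e show ?case by (intro exI[of _ "c # e"]) auto
qed auto

text \<open>\<open>connect\<close> needs a prefix that leaves exactly \<open>N - 1\<close> letters,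
  while \<open>v\<close> may be shorter. So a lift of \<open>v\<close> is lengthened on the left by
  \<open>N\<close> symbols \<open>e\<close>, reconnected to \<open>x\<close>, and the
  \<open>N\<close> extra symbols are dropped.\<close>

lemma W_nonempty:
  assumes "follows v b" "x \<in> D b"
  shows "W v x \<noteq> {}"
proof -
  obtain t a where t: "t \<in> D b" "map p a = v" "prepend a t \<in> SFT A"
    using assms(1) by (auto simp: follows_def W_def)
  obtain e where e: "length e = N" "prepend e (prepend a t) \<in> SFT A"
    using prepend_word_exists[OF t(3)] by blast
  \<comment> \<open>This cut leaves \<open>N - 1\<close> of the \<open>N + length a\<close>
    letters.\<close>
  define u where "u = take (length a + 1) (e @ a)"
  define u' where "u' = drop (length a + 1) (e @ a)"
  have uu: "u @ u' = e @ a" unfolding u_def u'_def by (rule append_take_drop_id)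
  have "follows (map p u @ map p u') b"
    using t(1) e(2) unfolding map_append[symmetric] uu
    by (auto simp: follows_def W_def prepend_append intro!: exI[of _ "e @ a"])
  moreover have "u \<noteq> []" using N0 e(1) by (auto simp: u_def)
  moreover have "prepend u (prepend u' t) \<in> SFT A"
    using e(2) by (simp add: uu flip: prepend_append)
  moreover have "length (map p u') + 1 = N" using e(1) N0 by (simp add: u'_def)
  ultimately obtain a' where a': "u @ a' \<in> W (map p u @ map p u') x"
    using assms(2) by (rule connect)
  then have m: "map p (u @ a') = map p e @ map p a" "prepend (u @ a') x \<in> SFT A"
    unfolding map_append[symmetric] uu by (auto simp: W_def)
  then have "map p (drop N (u @ a')) = v"
    using e(1) t(2) by (metis append_eq_conv_conj drop_map length_map)
  moreover have "prepend (drop N (u @ a')) x \<in> SFT A"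
    using m(2) unfolding prepend_append[of "take N (u @ a')" "drop N (u @ a')", unfolded append_take_drop_id]
      prepend_in_SFT_iff[of "take N (u @ a')"] by blast
  ultimately show ?thesis unfolding W_def by blast
qed

lemma Z_pos:
  assumes "follows v b" "x \<in> D b" "\<And>z. z \<in> D (hd (v @ [b])) \<Longrightarrow> 0 < h z"
  shows "0 < Z v h x"
  unfolding Z_def
  using W_nonempty[OF assms(1,2)] finite_W assms(3) prepend_in_D assms(2)
  by (intro sum_pos) auto

text \<open>As \<open>k > 0\<close>, both points have the same lifts, and the distortion of the
  weights applies term by term.\<close>

lemma Z_one_distortion:
  assumes "x \<in> SFT A" "x' \<in> SFT A" "0 < k" "\<And>i. i < k \<Longrightarrow> x i = x' i"
  shows "Z v (\<lambda>_. 1) x \<le> exp (C1 * \<theta> ^ k) * Z v (\<lambda>_. 1) x'"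
proof -
  have W: "W v x = W v x'" using assms by (intro W_cong) auto
  have "weight \<phi> a x \<le> C1 * \<theta> ^ k + weight \<phi> a x'" if "a \<in> W v x'" for a
  proof -
    have "prepend a x \<in> SFT A" "prepend a x' \<in> SFT A" using that W by (auto simp: W_def)
    from weight_distortion[OF this assms(4)] show ?thesis by fastforce
  qed
  then show ?thesis
    unfolding Z_def W sum_distrib_left by (intro sum_mono) (simp flip: exp_add)
qed

subsection \<open>Contraction\<close>

text \<open>Chosen with \<open>4 * C1 \<le> K / 2\<close>, so that distortion costs at most half of
  \<open>K\<close> in \<open>lip_contraction\<close>; the summand 1 keeps \<open>K\<close>
  positive.\<close>

definition K :: real where "K = 8 * C1 + 1"

text \<open>Lipschitz continuity with constant \<open>c\<close> on \<open>D b\<close> for the metric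
  \<open>min 1 (K \<theta>\<^sup>k)\<close>, where \<open>k\<close> is the length of the common prefix; for large \<open>K\<close> the normalized
  fiber operators contract it.\<close>

definition lip :: "real \<Rightarrow> 'b \<Rightarrow> ((nat \<Rightarrow> 'a) \<Rightarrow> real) \<Rightarrow> bool" where
  "lip c b f \<longleftrightarrow> (\<forall>x\<in>D b. \<forall>x'\<in>D b. \<bar>f x - f x'\<bar> \<le> c \<and>
    (\<forall>k>0. (\<forall>i<k. x i = x' i) \<longrightarrow> \<bar>f x - f x'\<bar> \<le> c * K * \<theta> ^ k))"

text \<open>The Doeblin constant of \<open>normalized_oscillation\<close>: the number of connecting
  words times a bound for the ratio of two weights. In the exponent, one \<open>C1\<close> pays for
  the common prefix, one for the function \<open>h\<close>, and the rest for the two connecting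
  words.\<close>

definition B :: real where
  "B = real (card {d :: 'a list. length d = N - 1}) * exp (2 * C1 + 2 * s * real (N - 1))"

lemma K_pos: "0 < K"
  using C1_nonneg by (simp add: K_def)

lemma finite_words: "finite {d :: 'a list. length d = n}"
  using finite_lists_length_eq[of "UNIV :: 'a set" n] by simp

lemma B_pos: "0 < B"
proof -
  have "replicate (N - 1) undefined \<in> {d :: 'a list. length d = N - 1}" by simp
  then have "0 < card {d :: 'a list. length d = N - 1}"
    using finite_words card_gt_0_iff by blast
  then show ?thesis by (simp add: B_def)
qed

text \<open>The first entry is the contraction factor for nearby points, the second the one for the
  oscillation; see \<open>lip_contraction\<close>.\<close>

definition \<rho> :: real where "\<rho> = max (3 / 4) (1 - 1 / (2 * B\<^sup>2))"

lemma rho_bounds: "0 < \<rho>" "\<rho> < 1"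
  using B_pos by (auto simp: \<rho>_def less_max_iff_disj)

text \<open>Here \<open>h\<close> is the mass contributed by the earlier word \<open>u\<close>, so
  the quotients are averages with Markov weights. Two errors add up: \<open>f\<close> is evaluated
  at points agreeing in \<open>k + length v\<close> symbols, and the weights differ by a factor near
  1, which costs \<open>4 * C1 * \<theta> ^ k\<close> times the oscillation of
  \<open>f\<close>.\<close>

lemma normalized_variation:
  assumes f: "lip c b0 f" and c: "0 \<le> c" and b0: "b0 = hd (v @ [b])"
    and u: "follows (u @ v) b"
    and x: "x \<in> D b" "x' \<in> D b" and k: "0 < k" "\<And>i. i < k \<Longrightarrow> x i = x' i"
  defines "h \<equiv> Z u (\<lambda>_. 1)"
  shows "\<bar>Z v (\<lambda>z. h z * f z) x / Z v h x - Z v (\<lambda>z. h z * f z) x' / Z v h x'\<bar>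
     \<le> c * K * \<theta> ^ (k + length v) + 4 * C1 * \<theta> ^ k * c"
proof -
  have X: "x \<in> SFT A" "x' \<in> SFT A" using x by (auto simp: D_def)
  have W: "W v x' = W v x" using X k by (intro W_cong) auto
  have hpos: "0 < h z" if "z \<in> D b0" for z
    unfolding h_def using follows_append(1)[OF u] that b0 by (intro Z_pos) auto
  define q where "q y a = exp (weight \<phi> a y) * h (prepend a y)" for y a
  have Zh: "Z v h y = sum (q y) (W v y)" for y
    by (simp add: Z_def q_def)
  have Zf: "Z v (\<lambda>z. h z * f z) y = (\<Sum>a\<in>W v y. q y a * f (prepend a y))" for y
    by (simp add: Z_def q_def mult.assoc)
  have aD: "prepend a x \<in> D b0" "prepend a x' \<in> D b0" if "a \<in> W v x" for a
    using that prepend_in_D x W b0 by auto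
  have q0: "0 < q x a" "0 < q x' a" if "a \<in> W v x" for a
    using hpos aD[OF that] by (simp_all add: q_def)
  have Zpos: "0 < Z v h y" if "y \<in> D b" for y
    using follows_append(2)[OF u] that hpos b0 by (intro Z_pos) auto
  have agree: "prepend a x i = prepend a x' i" if "i < k + length a" for a i
    using that k(2) prepend_agree by blast
  \<comment> \<open>One \<open>C1 * \<theta> ^ k\<close> in the exponent comes from the Birkhoff
    weights and one from \<open>h\<close>.\<close>
  define E where "E = exp (2 * C1 * \<theta> ^ k)"
  have le: "q y a \<le> E * q y' a"
    if "a \<in> W v x" "(y, y') = (x, x') \<or> (y, y') = (x', x)" for a y y'
  proof -
    have mem: "prepend a y \<in> SFT A" "prepend a y' \<in> SFT A"
      using that aD by (auto simp: D_def)
    have "\<bar>weight \<phi> a y - weight \<phi> a y'\<bar> \<le> C1 * \<theta> ^ k"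
      using that k(2) by (intro weight_distortion mem) auto
    moreover have "h (prepend a y) \<le> exp (C1 * \<theta> ^ (k + length a)) * h (prepend a y')"
      unfolding h_def using that k(1) agree by (intro Z_one_distortion mem) auto
    moreover have "C1 * \<theta> ^ (k + length a) \<le> C1 * \<theta> ^ k"
      using C1_nonneg theta0 theta1 by (intro mult_left_mono power_decreasing) auto
    moreover have "0 < h (prepend a y)" "0 < h (prepend a y')"
      using that hpos aD[OF that(1)] by auto
    ultimately have "q y a \<le> exp (C1 * \<theta> ^ k + weight \<phi> a y') * (exp (C1 * \<theta> ^ k) * h (prepend a y'))"
      unfolding q_def
      by (intro mult_mono) (auto intro: order_trans mult_right_mono)
    moreover have "E = exp (C1 * \<theta> ^ k) * exp (C1 * \<theta> ^ k)"
      by (simp add: E_def flip: exp_add)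
    ultimately show ?thesis
      by (simp add: q_def exp_add mult_ac)
  qed
  have osc: "\<bar>f (prepend a x) - f (prepend a' x)\<bar> \<le> c" if "a \<in> W v x" "a' \<in> W v x" for a a'
    using f aD that by (auto simp: lip_def)
  have cl: "\<bar>f (prepend a x) - f (prepend a x')\<bar> \<le> c * K * \<theta> ^ (k + length v)" if "a \<in> W v x" for a
  proof -
    have "length a = length v" using that by (auto simp: W_def)
    then show ?thesis using f aD[OF that] agree[of _ a] k(1) by (simp add: lip_def)
  qed
  have Zp: "0 < sum (q x) (W v x)" "0 < sum (q x') (W v x)"
    using Zpos x Zh W by metis+
  have "\<bar>(\<Sum>a\<in>W v x. q x a * f (prepend a x)) / sum (q x) (W v x)
      - (\<Sum>a\<in>W v x. q x' a * f (prepend a x)) / sum (q x') (W v x)\<bar> \<le> (1 - 1 / E\<^sup>2) * c"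
    using le q0 osc Zp finite_W by (intro weighted_average_compare) (auto simp: less_imp_le E_def)
  moreover have "\<bar>(\<Sum>a\<in>W v x. q x' a * f (prepend a x)) / sum (q x') (W v x)
      - (\<Sum>a\<in>W v x. q x' a * f (prepend a x')) / sum (q x') (W v x)\<bar> \<le> c * K * \<theta> ^ (k + length v)"
    using q0 cl Zp by (intro weighted_average_close) (auto simp: less_imp_le)
  moreover have "(1 - 1 / E\<^sup>2) * c \<le> 4 * C1 * \<theta> ^ k * c"
  proof -
    have "1 / E\<^sup>2 = exp (- (4 * C1 * \<theta> ^ k))"
      by (simp add: E_def exp_minus divide_simps flip: exp_double)
    then show ?thesis
      using exp_ge_add_one_self[of "- (4 * C1 * \<theta> ^ k)"] c by (intro mult_right_mono) auto
  qed
  ultimately show ?thesis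
    unfolding Zf Zh W by linarith
qed

text \<open>Lifts are grouped by their first \<open>l\<close> letters and \<open>f\<close> is
  replaced by its value at one point per group, at the cost \<open>c * K * \<theta> ^ l\<close> for
  each base point. By fiber-wise mixing each group has comparable mass over \<open>x\<close> and
  over \<open>x'\<close>, so \<open>weighted_average_compare\<close> applies to the group
  masses.\<close>

lemma normalized_oscillation:
  assumes f: "lip c b0 f" and c: "0 \<le> c" and b0: "b0 = hd (v @ [b])"
    and u: "follows (u @ v) b"
    and x: "x \<in> D b" "x' \<in> D b" and l: "0 < l" "length v + 1 = l + N"
  defines "h \<equiv> Z u (\<lambda>_. 1)"
  shows "\<bar>Z v (\<lambda>z. h z * f z) x / Z v h x - Z v (\<lambda>z. h z * f z) x' / Z v h x'\<bar>
     \<le> 2 * (c * K * \<theta> ^ l) + (1 - 1 / B\<^sup>2) * c"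
proof -
  have hpos: "0 < h z" if "z \<in> D b0" for z
    unfolding h_def using follows_append(1)[OF u] that b0 by (intro Z_pos) auto
  define q where "q y a = exp (weight \<phi> a y) * h (prepend a y)" for y a
  have Zh: "Z v h y = sum (q y) (W v y)" for y
    by (simp add: Z_def q_def)
  have Zf: "Z v (\<lambda>z. h z * f z) y = (\<Sum>a\<in>W v y. q y a * f (prepend a y))" for y
    by (simp add: Z_def q_def mult.assoc)
  have aD: "prepend a y \<in> D b0" if "a \<in> W v y" "y \<in> D b" for a y
    using that prepend_in_D b0 by auto
  have q0: "0 < q y a" if "a \<in> W v y" "y \<in> D b" for a y
    using hpos aD[OF that] by (simp add: q_def)
  have Zp: "0 < sum (q y) (W v y)" if "y \<in> D b" for y
    unfolding Zh[symmetric] using follows_append(2)[OF u] that hpos b0 by (intro Z_pos) auto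
  define U where "U = {u. map p u = take l v \<and> (\<exists>z. prepend u z \<in> SFT A)}"
  \<comment> \<open>The representative depends on the prefix alone and not on the base point, so the
    same values are averaged over \<open>x\<close> and over \<open>x'\<close>.\<close>
  define pt where "pt u = prepend u (SOME z. prepend u z \<in> SFT A)" for u
  define Q where "Q y u = sum (q y) {a \<in> W v y. take l a = u}" for y u
  have lenU: "length u = l" if "u \<in> U" for u
  proof -
    have "length (map p u) = length (take l v)" using that by (simp add: U_def)
    then show ?thesis using l N0 by simp
  qed
  have lenW: "length a = length v" if "a \<in> W v y" for a y
    using that by (auto simp: W_def)
  have finU: "finite U"
    by (rule finite_subset[OF _ finite_words[of l]]) (use lenU in auto)
  have takeU: "take l a \<in> U" if "a \<in> W v y" for a y
  proof -
    have "prepend (take l a) (prepend (drop l a) y) \<in> SFT A"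
      using that by (simp add: W_def flip: prepend_append)
    then show ?thesis using that by (auto simp: U_def W_def take_map)
  qed
  have group: "(\<Sum>u\<in>U. \<Sum>a\<in>{a \<in> W v y. take l a = u}. F a) = (\<Sum>a\<in>W v y. F a)"
    for F :: "'a list \<Rightarrow> real" and y
    using takeU by (intro sum.group finite_W finU) auto
  have sumQ: "sum (Q y) U = sum (q y) (W v y)" for y
    unfolding Q_def by (rule group)
  have Qg: "(\<Sum>a\<in>W v y. q y a * f (pt (take l a))) = (\<Sum>u\<in>U. Q y u * f (pt u))" for y
    unfolding group[symmetric] Q_def sum_distrib_right by (intro sum.cong) auto
  have pt: "pt u \<in> SFT A" if "u \<in> U" for u
    using that someI_ex[of "\<lambda>z. prepend u z \<in> SFT A"] by (simp add: U_def pt_def)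
  have ptD: "pt u \<in> D b0" if "u \<in> U" for u
  proof -
    have "hd (map p u) = hd (take l v)" "u \<noteq> []" "v \<noteq> []"
      using that lenU[OF that] l by (auto simp: U_def)
    then have "p (hd u) = hd v" using l(1) by (simp add: hd_map)
    then show ?thesis
      using pt[OF that] b0 \<open>u \<noteq> []\<close> \<open>v \<noteq> []\<close> by (simp add: D_def pt_def prepend_0)
  qed
  have near: "\<bar>f (prepend a y) - f (pt (take l a))\<bar> \<le> c * K * \<theta> ^ l"
    if "a \<in> W v y" "y \<in> D b" for a y
  proof -
    have "prepend a y i = pt (take l a) i" if "i < l" for i
      using that lenU[OF takeU[OF \<open>a \<in> W v y\<close>]] by (auto simp: prepend_nth pt_def)
    then show ?thesis
      using f aD[OF that] ptD[OF takeU[OF that(1)]] l(1) by (auto simp: lip_def)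
  qed
  \<comment> \<open>All members of the group over \<open>y\<close> are compared with the single word
    \<open>w @ e'\<close> over \<open>y'\<close>; counting the members gives the cardinality in
    \<open>B\<close>.\<close>
  have QB: "Q y w \<le> B * Q y' w" if w: "w \<in> U" and y: "y \<in> D b" "y' \<in> D b" for w y y'
  proof -
    have vw: "map p w @ drop l v = v" using w by (simp add: U_def)
    have "u @ v = u @ map p w @ drop l v" using vw by simp
    then have fw: "follows (map p w @ drop l v) b" using follows_append(2)[OF u] vw by simp
    obtain z where "prepend w z \<in> SFT A" using w by (auto simp: U_def)
    moreover have "w \<noteq> []" using lenU[OF w] l by auto
    moreover have "length (drop l v) + 1 = N" using l N0 by simp
    ultimately obtain e' where e': "w @ e' \<in> W v y'"
      using connect[OF fw] y(2) vw by metis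
    define E where "E = exp (2 * C1 + 2 * s * real (N - 1))"
    have qE: "q y (w @ e) \<le> E * q y' (w @ e')" if e: "w @ e \<in> W v y" for e
    proof -
      have len: "length e = N - 1" "length e' = N - 1"
        using lenW[OF e] lenW[OF e'] lenU[OF w] l by auto
      have X: "prepend w (prepend e y) \<in> SFT A" "prepend w (prepend e' y') \<in> SFT A"
        using e e' by (auto simp: W_def prepend_append)
      then have X': "prepend e y \<in> SFT A" "prepend e' y' \<in> SFT A"
        by (auto simp: prepend_in_SFT_iff[of w])
      \<comment> \<open>The points behind \<open>w\<close> need not agree anywhere, so distortion is
        used with exponent 0.\<close>
      have "\<bar>weight \<phi> w (prepend e y) - weight \<phi> w (prepend e' y')\<bar> \<le> C1 * \<theta> ^ 0"
        using X by (rule weight_distortion) auto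
      moreover have "\<bar>weight \<phi> e y\<bar> \<le> s * real (N - 1)" "\<bar>weight \<phi> e' y'\<bar> \<le> s * real (N - 1)"
        using weight_bound[OF X'(1)] weight_bound[OF X'(2)] len by auto
      ultimately have 1: "weight \<phi> (w @ e) y \<le> C1 + 2 * s * real (N - 1) + weight \<phi> (w @ e') y'"
        unfolding weight_append by simp
      have "h (prepend (w @ e) y) \<le> exp (C1 * \<theta> ^ l) * h (prepend (w @ e') y')"
        unfolding h_def prepend_append using X l(1) lenU[OF w]
        by (intro Z_one_distortion) (auto simp: prepend_nth)
      also have "\<dots> \<le> exp C1 * h (prepend (w @ e') y')"
        using hpos[OF aD[OF e' y(2)]] C1_nonneg theta_power_le_1
        by (intro mult_right_mono) (auto intro: mult_left_le)
      finally have "q y (w @ e) \<le> exp (C1 + 2 * s * real (N - 1) + weight \<phi> (w @ e') y') * (exp C1 * h (prepend (w @ e') y'))"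
        unfolding q_def using 1 hpos[OF aD[OF e y(1)]] by (intro mult_mono) auto
      also have "\<dots> = E * q y' (w @ e')"
        by (simp add: E_def q_def flip: exp_add mult.assoc)
      finally show ?thesis .
    qed
    define S where "S = {a \<in> W v y. take l a = w}"
    have "S \<subseteq> (@) w ` {d. length d = N - 1}"
    proof
      fix a assume a: "a \<in> S"
      then have "a = w @ drop l a" by (metis (mono_tags, lifting) S_def append_take_drop_id mem_Collect_eq)
      moreover have "length (drop l a) = N - 1"
        using a lenW[of a y] l by (auto simp: S_def)
      ultimately show "a \<in> (@) w ` {d. length d = N - 1}" by blast
    qed
    then have "card S \<le> card ((@) w ` {d :: 'a list. length d = N - 1})"
      by (intro card_mono finite_imageI finite_words)
    also have "\<dots> \<le> card {d :: 'a list. length d = N - 1}"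
      by (intro card_image_le finite_words)
    finally have cS: "card S \<le> card {d :: 'a list. length d = N - 1}" .
    have qe': "0 < q y' (w @ e')" using q0[OF e' y(2)] .
    have "Q y w \<le> (\<Sum>a\<in>S. E * q y' (w @ e'))"
      unfolding Q_def S_def[symmetric]
    proof (rule sum_mono)
      fix a assume a: "a \<in> S"
      then have "a = w @ drop l a" by (metis (mono_tags, lifting) S_def append_take_drop_id mem_Collect_eq)
      with a show "q y a \<le> E * q y' (w @ e')"
        using qE[of "drop l a"] by (auto simp: S_def)
    qed
    also have "\<dots> \<le> real (card {d :: 'a list. length d = N - 1}) * (E * q y' (w @ e'))"
      using cS qe' by (simp add: E_def)
    also have "\<dots> = B * q y' (w @ e')" by (simp add: B_def E_def)
    also have "\<dots> \<le> B * Q y' w"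
      unfolding Q_def using e' lenU[OF w] finite_W q0[OF _ y(2)] B_pos
      by (intro mult_left_mono member_le_sum) (auto simp: less_imp_le)
    finally show ?thesis .
  qed
  have Q0: "0 \<le> Q y w" if "y \<in> D b" for y w
    unfolding Q_def using q0 that by (intro sum_nonneg) (auto simp: less_imp_le)
  have main: "\<bar>(\<Sum>u\<in>U. Q x u * f (pt u)) / sum (Q x) U - (\<Sum>u\<in>U. Q x' u * f (pt u)) / sum (Q x') U\<bar>
      \<le> (1 - 1 / B\<^sup>2) * c"
    using finU Q0 QB x Zp sumQ B_pos f ptD
    by (intro weighted_average_compare) (auto simp: lip_def)
  have close: "\<bar>(\<Sum>a\<in>W v y. q y a * f (prepend a y)) / sum (q y) (W v y)
      - (\<Sum>u\<in>U. Q y u * f (pt u)) / sum (Q y) U\<bar> \<le> c * K * \<theta> ^ l" if "y \<in> D b" for y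
    unfolding Qg[symmetric] sumQ using q0 near Zp that
    by (intro weighted_average_close) (auto simp: less_imp_le)
  show ?thesis
    unfolding Zf Zh using main close[OF x(1)] close[OF x(2)] by linarith
qed

text \<open>The first smallness condition absorbs the error \<open>2 * K * \<theta> ^ l\<close> into
  half of the Doeblin gain \<open>1 / B\<^sup>2\<close>. The second, with
  \<open>length v \<ge> l\<close>, leaves a quarter of the old Lipschitz constant, to which the
  choice of \<open>K\<close> adds at most a half for distortion.\<close>

lemma lip_contraction:
  assumes f: "lip c (hd (v @ [b])) f" and c: "0 \<le> c" and u: "follows (u @ v) b"
    and l: "0 < l" "length v + 1 = l + N" and small: "4 * K * \<theta> ^ l \<le> 1 / B\<^sup>2" "\<theta> ^ l \<le> 1 / 4"
  shows "lip (\<rho> * c) b (\<lambda>x. Z v (\<lambda>z. Z u (\<lambda>_. 1) z * f z) x / Z v (Z u (\<lambda>_. 1)) x)"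
  unfolding lip_def
proof (intro ballI conjI allI impI)
  fix x x' assume x: "x \<in> D b" "x' \<in> D b"
  let ?d = "\<bar>Z v (\<lambda>z. Z u (\<lambda>_. 1) z * f z) x / Z v (Z u (\<lambda>_. 1)) x
    - Z v (\<lambda>z. Z u (\<lambda>_. 1) z * f z) x' / Z v (Z u (\<lambda>_. 1)) x'\<bar>"
  have "?d \<le> 2 * (c * K * \<theta> ^ l) + (1 - 1 / B\<^sup>2) * c"
    by (rule normalized_oscillation[OF f c refl u x l])
  also have "\<dots> = (2 * K * \<theta> ^ l + 1 - 1 / B\<^sup>2) * c" by (simp add: algebra_simps)
  also have "\<dots> \<le> \<rho> * c"
    using small(1) c by (intro mult_right_mono) (auto simp: \<rho>_def le_max_iff_disj)
  finally show "?d \<le> \<rho> * c" .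
  fix k :: nat assume k: "0 < k" "\<forall>i<k. x i = x' i"
  have "?d \<le> c * K * \<theta> ^ (k + length v) + 4 * C1 * \<theta> ^ k * c"
    using k by (intro normalized_variation[OF f c refl u x]) auto
  also have "\<dots> \<le> c * K * (\<theta> ^ k * (1 / 4)) + 4 * C1 * \<theta> ^ k * c"
  proof -
    have "\<theta> ^ (k + length v) \<le> \<theta> ^ k * \<theta> ^ l"
      unfolding power_add[symmetric] using theta0 theta1 l N0 by (intro power_decreasing) auto
    also have "\<dots> \<le> \<theta> ^ k * (1 / 4)"
      using small(2) theta0 by (intro mult_left_mono) auto
    finally show ?thesis using c K_pos by (intro add_right_mono mult_left_mono) auto
  qed
  also have "c * K * (\<theta> ^ k * (1 / 4)) + 4 * C1 * \<theta> ^ k * c \<le> 3 / 4 * (c * K * \<theta> ^ k)"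
    using theta0 c by (simp add: K_def algebra_simps)
  also have "\<dots> \<le> \<rho> * (c * K * \<theta> ^ k)"
    using theta0 c K_pos by (intro mult_right_mono) (auto simp: \<rho>_def)
  finally show "?d \<le> \<rho> * c * K * \<theta> ^ k"
    by (simp add: mult_ac)
qed

section \<open>Iterating the contraction along a word\<close>

lemma Z_mono:
  assumes "x \<in> D b" "\<And>z. z \<in> D (hd (v @ [b])) \<Longrightarrow> f z \<le> g z"
  shows "Z v f x \<le> Z v g x"
  unfolding Z_def using assms prepend_in_D by (intro sum_mono mult_left_mono) auto

lemma Z_cong:
  assumes "x \<in> D b" "\<And>z. z \<in> D (hd (v @ [b])) \<Longrightarrow> f z = g z"
  shows "Z v f x = Z v g x"
  by (rule antisym) (use assms in \<open>auto intro!: Z_mono\<close>)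

lemma Z_scale: "Z v (\<lambda>z. c * f z) x = c * Z v f x"
  by (simp add: Z_def sum_distrib_left algebra_simps)

text \<open>Mediant inequality: by \<open>Z_append\<close> the quotient for \<open>u @ v\<close> is
  a weighted average of quotients for \<open>u\<close> at points over the first letter of
  \<open>v @ [b]\<close>. So lengthening a word on the right never enlarges the range of the
  quotient.\<close>

lemma ratio_between:
  assumes u: "follows (u @ v) b" and x: "x \<in> D b"
    and h: "\<And>z. z \<in> D (hd (u @ v @ [b])) \<Longrightarrow> 0 < h z"
    and f: "\<And>z. z \<in> D (hd (v @ [b])) \<Longrightarrow> lo \<le> Z u f z / Z u h z \<and> Z u f z / Z u h z \<le> hi"
  shows "lo \<le> Z (u @ v) f x / Z (u @ v) h x" "Z (u @ v) f x / Z (u @ v) h x \<le> hi"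
proof -
  have eq: "hd (u @ [hd (v @ [b])]) = hd (u @ v @ [b])" by (cases u) auto
  have pos: "0 < Z u h z" if "z \<in> D (hd (v @ [b]))" for z
    using that h eq by (intro Z_pos[OF follows_append(1)[OF u]]) auto
  have pos': "0 < Z (u @ v) h x"
    using h by (intro Z_pos[OF u x]) auto
  have "lo * Z u h z \<le> Z u f z" "Z u f z \<le> hi * Z u h z" if "z \<in> D (hd (v @ [b]))" for z
    using f[OF that] pos[OF that] by (auto simp: field_simps)
  then have "Z v (\<lambda>z. lo * Z u h z) x \<le> Z v (Z u f) x" "Z v (Z u f) x \<le> Z v (\<lambda>z. hi * Z u h z) x"
    by (auto intro!: Z_mono[OF x])
  then show "lo \<le> Z (u @ v) f x / Z (u @ v) h x" "Z (u @ v) f x / Z (u @ v) h x \<le> hi"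
    using pos' by (auto simp: Z_scale Z_append field_simps)
qed

text \<open>The word is cut into \<open>j\<close> blocks of length \<open>n = l + N - 1\<close>. In
  the induction the quotient for all blocks but the last plays the role of \<open>f\<close> in
  \<open>lip_contraction\<close>, so each block contributes one factor
  \<open>\<rho>\<close>.\<close>

lemma lip_iterate:
  assumes l: "0 < l" "n + 1 = l + N" and small: "4 * K * \<theta> ^ l \<le> 1 / B\<^sup>2" "\<theta> ^ l \<le> 1 / 4"
    and c: "0 \<le> c"
  shows "lip c (hd (v @ [b])) f \<Longrightarrow> follows v b \<Longrightarrow> length v = j * n \<Longrightarrow>
    lip (\<rho> ^ j * c) b (\<lambda>x. Z v f x / Z v (\<lambda>_. 1) x)"
proof (induction j arbitrary: v b)
  case 0
  then show ?case by (auto simp: lip_def D_def Z_Nil)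
next
  case (Suc j)
  define u w where "u = take (j * n) v" and "w = drop (j * n) v"
  have v: "v = u @ w" by (simp add: u_def w_def)
  have len: "length u = j * n" "length w + 1 = l + N"
    using Suc.prems(3) l by (auto simp: u_def w_def)
  let ?b = "hd (w @ [b])"
  have fol: "follows (u @ w) b" using Suc.prems(2) v by simp
  have hd: "hd (u @ [?b]) = hd (v @ [b])" unfolding v by (cases u) auto
  let ?f = "\<lambda>x. Z u f x / Z u (\<lambda>_. 1) x"
  have "lip (\<rho> ^ j * c) ?b ?f"
    using Suc.prems(1) hd by (intro Suc.IH follows_append(1)[OF fol] len) auto
  then have "lip (\<rho> * (\<rho> ^ j * c)) b (\<lambda>x. Z w (\<lambda>z. Z u (\<lambda>_. 1) z * ?f z) x / Z w (Z u (\<lambda>_. 1)) x)"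
    using c rho_bounds by (intro lip_contraction[OF _ _ fol l(1) len(2) small]) auto
  moreover have "Z w (\<lambda>z. Z u (\<lambda>_. 1) z * ?f z) x / Z w (Z u (\<lambda>_. 1)) x
      = Z v f x / Z v (\<lambda>_. 1) x" if "x \<in> D b" for x
  proof -
    \<comment> \<open>The denominator of the inner quotient cancels against the weight, leaving the
      operator of the whole word.\<close>
    have "Z w (\<lambda>z. Z u (\<lambda>_. 1) z * ?f z) x = Z w (Z u f) x"
    proof (rule Z_cong[OF that])
      fix z assume "z \<in> D (hd (w @ [b]))"
      then have "0 < Z u (\<lambda>_. 1) z" by (intro Z_pos[OF follows_append(1)[OF fol]]) auto
      then show "Z u (\<lambda>_. 1) z * ?f z = Z u f z" by simp
    qed
    then show ?thesis by (simp add: v Z_append)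
  qed
  ultimately show ?case by (simp add: lip_def mult.assoc)
qed

section \<open>Exponential convergence of the ratios\<close>

definition M :: real where "M = real (card {d :: 'a list. length d = 1}) * exp s"

lemma Z_one_ge:
  assumes "follows v b" "x \<in> D b"
  shows "exp (- (s * real (length v))) \<le> Z v (\<lambda>_. 1) x"
proof -
  obtain a where a: "a \<in> W v x" using W_nonempty[OF assms] by blast
  then have "\<bar>weight \<phi> a x\<bar> \<le> s * real (length v)"
    using weight_bound[of a x] by (auto simp: W_def)
  then have "exp (- (s * real (length v))) \<le> exp (weight \<phi> a x) * 1" by simp
  also have "\<dots> \<le> Z v (\<lambda>_. 1) x"
    unfolding Z_def using a finite_W by (intro member_le_sum) auto
  finally show ?thesis .
qed

lemma Z_singleton_le: "Z [b0] (\<lambda>_. 1) x \<le> M"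
proof -
  have "Z [b0] (\<lambda>_. 1) x \<le> (\<Sum>a\<in>W [b0] x. exp s)"
    unfolding Z_def
  proof (rule sum_mono)
    fix a assume "a \<in> W [b0] x"
    then show "exp (weight \<phi> a x) * 1 \<le> exp s"
      using weight_bound[of a x] by (auto simp: W_def)
  qed
  also have "\<dots> \<le> M"
  proof -
    have "W [b0] x \<subseteq> {d. length d = 1}" by (auto simp: W_def)
    from card_mono[OF finite_words this] show ?thesis by (simp add: M_def)
  qed
  finally show ?thesis .
qed

lemma M_nonneg: "0 \<le> M"
  by (simp add: M_def)

text \<open>The starting function for \<open>lip_iterate\<close>. Multiplicative distortion becomes
  additive through \<open>1 - t \<le> exp (- t)\<close> and the upper bound \<open>M\<close>;
  \<open>C1 \<le> K\<close> absorbs the constant.\<close>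

lemma lip_singleton: "lip M b (Z [b0] (\<lambda>_. 1))"
proof -
  let ?f = "Z [b0] (\<lambda>_. 1)"
  have nn: "0 \<le> ?f x" for x unfolding Z_def by (intro sum_nonneg) auto
  have up: "?f x - ?f x' \<le> M * K * \<theta> ^ k"
    if "x \<in> SFT A" "x' \<in> SFT A" "0 < k" "\<forall>i<k. x i = x' i" for x x' k
  proof -
    have "?f x' \<ge> exp (- (C1 * \<theta> ^ k)) * ?f x"
      using Z_one_distortion[of x x' k "[b0]"] that by (simp add: exp_minus field_simps)
    moreover have "exp (- (C1 * \<theta> ^ k)) * ?f x \<ge> (1 - C1 * \<theta> ^ k) * ?f x"
      using nn exp_ge_add_one_self[of "- (C1 * \<theta> ^ k)"] by (intro mult_right_mono) auto
    ultimately have "?f x - ?f x' \<le> C1 * \<theta> ^ k * ?f x" by (simp add: algebra_simps)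
    also have "\<dots> \<le> K * \<theta> ^ k * M"
      using nn Z_singleton_le C1_nonneg theta0 by (intro mult_mono) (auto simp: K_def)
    finally show ?thesis by (simp add: mult_ac)
  qed
  have "\<bar>?f x - ?f x'\<bar> \<le> M" for x x'
    using nn[of x] nn[of x'] Z_singleton_le[of b0 x] Z_singleton_le[of b0 x'] by linarith
  moreover have "\<bar>?f x - ?f x'\<bar> \<le> M * K * \<theta> ^ k"
    if "x \<in> SFT A" "x' \<in> SFT A" "0 < k" "\<forall>i<k. x i = x' i" for x x' k
    using up[of x x' k] up[of x' x k] that by fastforce
  ultimately show ?thesis by (auto simp: lip_def D_def)
qed

text \<open>Finite-word approximation of \<open>exp \<psi>\<close>; by \<open>R_eq\<close> it is an
  average of \<open>Z [b0] (\<lambda>_. 1)\<close>, to which the contraction applies.\<close>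

definition R :: "'b \<Rightarrow> 'b list \<Rightarrow> (nat \<Rightarrow> 'a) \<Rightarrow> real" where
  "R b0 v x = Z (b0 # v) (\<lambda>_. 1) x / Z v (\<lambda>_. 1) x"

lemma R_eq: "R b0 v x = Z v (Z [b0] (\<lambda>_. 1)) x / Z v (\<lambda>_. 1) x"
  using Z_append[of "[b0]" v] by (simp add: R_def)

lemma R_bounds:
  assumes "follows (b0 # v) b" "x \<in> D b"
  shows "exp (- s) \<le> R b0 v x" "R b0 v x \<le> M"
proof -
  have fol: "follows ([b0] @ v) b" using assms(1) by simp
  have "exp (- s) \<le> Z [b0] (\<lambda>_. 1) z" if "z \<in> D (hd (v @ [b]))" for z
    using Z_one_ge[OF follows_append(1)[OF fol] that] by simp
  \<comment> \<open>Quotients for the empty word, with denominator 1, bring pointwise bounds into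
    the form that \<open>ratio_between\<close> expects.\<close>
  then have "exp (- s) \<le> Z [] (Z [b0] (\<lambda>_. 1)) z / Z [] (\<lambda>_. 1) z
      \<and> Z [] (Z [b0] (\<lambda>_. 1)) z / Z [] (\<lambda>_. 1) z \<le> M" if "z \<in> D (hd (v @ [b]))" for z
    using that Z_singleton_le by (auto simp: D_def Z_Nil)
  from ratio_between[of "[]" v b x "\<lambda>_. 1", simplified, OF follows_append(2)[OF fol] assms(2) this]
  show "exp (- s) \<le> R b0 v x" "R b0 v x \<le> M" by (auto simp: R_eq)
qed

text \<open>By \<open>ratio_between\<close> the ratio for \<open>u @ v\<close> is an average of
  ratios for \<open>u\<close>, so its distance to any of them is at most their oscillation, which
  decays with \<open>length u\<close>. Uniformity in \<open>v\<close> and in the base points serves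
  both convergence and Hoelder continuity.\<close>

lemma R_decay:
  "\<exists>E \<sigma>. 0 \<le> E \<and> 0 < \<sigma> \<and> \<sigma> < 1 \<and> (\<forall>b0 u v b x z. follows (b0 # u @ v) b \<longrightarrow> x \<in> D b
    \<longrightarrow> z \<in> D (hd (v @ [b])) \<longrightarrow> \<bar>R b0 (u @ v) x - R b0 u z\<bar> \<le> E * \<sigma> ^ length u)"
proof -
  \<comment> \<open>The two entries produce the two smallness conditions of
    \<open>lip_contraction\<close>.\<close>
  define e where "e = min (1 / 4) (1 / (4 * K * B\<^sup>2))"
  have "0 < e" using K_pos B_pos by (simp add: e_def)
  then obtain l0 where l0: "\<theta> ^ l0 < e"
    using real_arch_pow_inv[of e \<theta>] theta1 by blast
  define l where "l = Suc l0"
  define n where "n = l + N - 1"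
  have l: "0 < l" "n + 1 = l + N" and n: "0 < n" using N0 by (auto simp: l_def n_def)
  have "\<theta> ^ l \<le> \<theta> ^ l0"
    unfolding l_def using theta0 theta1 by (intro power_decreasing) auto
  with l0 have "\<theta> ^ l \<le> 1 / 4" "\<theta> ^ l \<le> 1 / (4 * K * B\<^sup>2)"
    by (auto simp: e_def)
  then have small: "4 * K * \<theta> ^ l \<le> 1 / B\<^sup>2" "\<theta> ^ l \<le> 1 / 4"
    using K_pos B_pos by (auto simp: field_simps)
  define \<sigma> where "\<sigma> = root n \<rho>"
  have \<sigma>: "0 < \<sigma>" "\<sigma> < 1" "\<sigma> ^ n = \<rho>"
    using rho_bounds n by (auto simp: \<sigma>_def)
  \<comment> \<open>Rounding down to full blocks loses less than one block, hence the factor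
    \<open>1 / \<rho>\<close>.\<close>
  have geometric: "\<rho> ^ (m div n) \<le> 1 / \<rho> * \<sigma> ^ m" for m
  proof -
    have "\<rho> ^ (m div n) * \<rho> = \<sigma> ^ (n * (m div n) + n)"
      by (simp add: power_add power_mult \<sigma>)
    also have "\<dots> \<le> \<sigma> ^ m"
      using \<sigma> n dividend_less_div_times[of n m]
      by (intro power_decreasing) (auto simp: mult.commute)
    finally show ?thesis using rho_bounds by (simp add: field_simps)
  qed
  have osc: "\<bar>R b0 v x - R b0 v x'\<bar> \<le> \<rho> ^ (length v div n) * M"
    if fol: "follows (b0 # v) b" and x: "x \<in> D b" "x' \<in> D b" for b0 v b x x'
  proof -
    let ?j = "length v div n"
    let ?e = "\<rho> ^ ?j * M"
    \<comment> \<open>Only the full blocks in \<open>u\<close> contract; the remainder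
      \<open>w\<close> does not increase the oscillation, by \<open>ratio_between\<close>.\<close>
    define u w where "u = take (?j * n) v" and "w = drop (?j * n) v"
    have v: "v = u @ w" by (simp add: u_def w_def)
    have fol': "follows (u @ w) b" using follows_append(2)[of "[b0]" v b] fol v by simp
    have "lip ?e (hd (w @ [b])) (R b0 u)"
      unfolding R_eq
    proof (rule lip_iterate[OF l small M_nonneg lip_singleton follows_append(1)[OF fol']])
      show "length u = ?j * n" by (simp add: u_def)
    qed
    then have z: "\<bar>R b0 u z - R b0 u z'\<bar> \<le> ?e"
      if "z \<in> D (hd (w @ [b]))" "z' \<in> D (hd (w @ [b]))" for z z'
      using that by (simp add: lip_def)
    have near: "lo \<le> R b0 v y \<and> R b0 v y \<le> hi"
      if "\<And>z. z \<in> D (hd (w @ [b])) \<Longrightarrow> lo \<le> R b0 u z \<and> R b0 u z \<le> hi" "y \<in> D b" for lo hi y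
      using ratio_between[OF fol' that(2), of "\<lambda>_. 1" lo "Z [b0] (\<lambda>_. 1)" hi] that(1)
      by (simp add: R_eq v)
    have 1: "R b0 u z - ?e \<le> R b0 v y \<and> R b0 v y \<le> R b0 u z + ?e"
      if "z \<in> D (hd (w @ [b]))" "y \<in> D b" for z y
    proof (rule near[OF _ that(2)])
      fix z' assume "z' \<in> D (hd (w @ [b]))"
      from z[OF that(1) this] show "R b0 u z - ?e \<le> R b0 u z' \<and> R b0 u z' \<le> R b0 u z + ?e"
        by (simp add: abs_le_iff)
    qed
    have "R b0 v x' - ?e \<le> R b0 v x \<and> R b0 v x \<le> R b0 v x' + ?e"
    proof (rule near[OF _ x(1)])
      fix z assume "z \<in> D (hd (w @ [b]))"
      from 1[OF this x(2)] show "R b0 v x' - ?e \<le> R b0 u z \<and> R b0 u z \<le> R b0 v x' + ?e"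
        by linarith
    qed
    then show ?thesis by linarith
  qed
  have "\<bar>R b0 (u @ v) x - R b0 u z\<bar> \<le> 1 / \<rho> * M * \<sigma> ^ length u"
    if fol: "follows (b0 # u @ v) b" and x: "x \<in> D b" "z \<in> D (hd (v @ [b]))" for b0 u v b x z
  proof -
    let ?e = "\<rho> ^ (length u div n) * M"
    have f1: "follows (b0 # u) (hd (v @ [b]))" using follows_append(1)[of "b0 # u" v b] fol by simp
    have f2: "follows (u @ v) b" using follows_append(2)[of "[b0]" "u @ v" b] fol by simp
    have b: "R b0 u z - ?e \<le> R b0 u z' \<and> R b0 u z' \<le> R b0 u z + ?e"
      if "z' \<in> D (hd (v @ [b]))" for z'
      using osc[OF f1 x(2) that] by (simp add: abs_le_iff)
    have "\<bar>R b0 (u @ v) x - R b0 u z\<bar> \<le> ?e"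
      using ratio_between[OF f2 x(1), of "\<lambda>_. 1" "R b0 u z - ?e" "Z [b0] (\<lambda>_. 1)" "R b0 u z + ?e"] b
      by (simp add: R_eq abs_le_iff)
    also have "\<dots> \<le> 1 / \<rho> * \<sigma> ^ length u * M"
      by (intro mult_right_mono geometric M_nonneg)
    finally show ?thesis by (simp add: mult_ac)
  qed
  with \<sigma> rho_bounds M_nonneg show ?thesis
    by (intro exI[of _ "1 / \<rho> * M"] exI[of _ \<sigma>]) auto
qed

subsection \<open>The potential\<close>

definition seg :: "(nat \<Rightarrow> 'a) \<Rightarrow> nat \<Rightarrow> nat \<Rightarrow> 'b list" where
  "seg x i j = map (\<lambda>k. p (x k)) [i..<j]"

lemma SFT_left_shift: "x \<in> SFT A \<Longrightarrow> (left_shift ^^ n) x \<in> SFT A"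
  by (simp add: SFT_def left_shift_funpow)

lemma left_shift_in_D: "x \<in> SFT A \<Longrightarrow> (left_shift ^^ n) x \<in> D (p (x n))"
  using SFT_left_shift[of x n] by (simp add: D_def left_shift_funpow)

lemma seg_append: "i \<le> j \<Longrightarrow> j \<le> k \<Longrightarrow> seg x i j @ seg x j k = seg x i k"
  by (simp add: seg_def upt_add_eq_append flip: map_append)
    (metis le_add_diff_inverse upt_add_eq_append)

lemma seg_Cons: "i < j \<Longrightarrow> seg x i j = p (x i) # seg x (Suc i) j"
  by (simp add: seg_def upt_conv_Cons)

lemma hd_seg: "i \<le> j \<Longrightarrow> hd (seg x i j @ [p (x j)]) = p (x i)"
  by (cases "i = j") (auto simp: seg_def hd_append hd_map)

lemma length_seg: "length (seg x i j) = j - i"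
  by (simp add: seg_def)

lemma follows_seg:
  assumes "x \<in> SFT A" "i \<le> j"
  shows "follows (seg x i j) (p (x j))"
proof -
  have "prepend (map x [i..<j]) ((left_shift ^^ j) x) = (left_shift ^^ i) x"
    by (rule ext) (use assms(2) in \<open>auto simp: prepend_nth left_shift_funpow add.commute\<close>)
  then have "map x [i..<j] \<in> W (seg x i j) ((left_shift ^^ j) x)"
    using SFT_left_shift[OF assms(1)] by (simp add: W_def seg_def)
  then show ?thesis
    using left_shift_in_D[OF assms(1), of j] by (auto simp: follows_def)
qed

text \<open>One estimate, \<open>close\<close>, yields both claims: for equal points it is the
  Cauchy property, for different points the regularity of the limit. It asks for agreement of
  \<open>n + 2\<close> images because the \<open>n\<close>-th ratio reads the images of symbols 0 to
  \<open>n\<close>, and its base point lies over the image of symbol \<open>n + 1\<close>.\<close>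

lemma ratio_limit:
  "\<exists>G E \<sigma>. 0 \<le> E \<and> 0 < \<sigma> \<and> \<sigma> < 1 \<and>
    (\<forall>x\<in>SFT A. (\<lambda>n. R (p (x 0)) (seg x 1 (Suc n)) ((left_shift ^^ Suc n) x)) \<longlonglongrightarrow> G x \<and>
       exp (- s) \<le> G x \<and> G x \<le> M) \<and>
    (\<forall>x\<in>SFT A. \<forall>x'\<in>SFT A. \<forall>n. (\<forall>i<n + 2. p (x i) = p (x' i)) \<longrightarrow> \<bar>G x - G x'\<bar> \<le> E * \<sigma> ^ n)"
proof -
  obtain E \<sigma> where E: "0 \<le> E" and \<sigma>: "0 < \<sigma>" "\<sigma> < 1"
    and decay: "\<And>b0 u v b x z. follows (b0 # u @ v) b \<Longrightarrow> x \<in> D b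
      \<Longrightarrow> z \<in> D (hd (v @ [b])) \<Longrightarrow> \<bar>R b0 (u @ v) x - R b0 u z\<bar> \<le> E * \<sigma> ^ length u"
    using R_decay by metis
  define F where "F x n = R (p (x 0)) (seg x 1 (Suc n)) ((left_shift ^^ Suc n) x)" for x n
  have fol: "follows (p (x 0) # seg x 1 (Suc n)) (p (x (Suc n)))" if "x \<in> SFT A" for x n
    using follows_seg[OF that, of 0 "Suc n"] by (simp add: seg_Cons)
  have Fb: "exp (- s) \<le> F x n \<and> F x n \<le> M" if "x \<in> SFT A" for x n
    unfolding F_def using R_bounds[OF fol[OF that] left_shift_in_D[OF that]] by auto
  have close: "\<bar>F x' m - F x n\<bar> \<le> E * \<sigma> ^ n"
    if x: "x \<in> SFT A" "x' \<in> SFT A" and agree: "\<forall>i<n + 2. p (x i) = p (x' i)" and m: "n \<le> m"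
    for x x' m n
  proof -
    have eq: "seg x 1 (Suc n) = seg x' 1 (Suc n)" "p (x 0) = p (x' 0)"
      using agree by (auto simp: seg_def)
    have split: "seg x' 1 (Suc n) @ seg x' (Suc n) (Suc m) = seg x' 1 (Suc m)"
      using m by (intro seg_append) auto
    have "\<bar>R (p (x' 0)) (seg x' 1 (Suc n) @ seg x' (Suc n) (Suc m)) ((left_shift ^^ Suc m) x')
        - R (p (x' 0)) (seg x' 1 (Suc n)) ((left_shift ^^ Suc n) x)\<bar> \<le> E * \<sigma> ^ length (seg x' 1 (Suc n))"
    proof (rule decay)
      show "follows (p (x' 0) # seg x' 1 (Suc n) @ seg x' (Suc n) (Suc m)) (p (x' (Suc m)))"
        unfolding split by (rule fol[OF x(2)])
      show "(left_shift ^^ Suc m) x' \<in> D (p (x' (Suc m)))" by (rule left_shift_in_D[OF x(2)])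
      have "hd (seg x' (Suc n) (Suc m) @ [p (x' (Suc m))]) = p (x (Suc n))"
        using m agree by (subst hd_seg) auto
      then show "(left_shift ^^ Suc n) x \<in> D (hd (seg x' (Suc n) (Suc m) @ [p (x' (Suc m))]))"
        using left_shift_in_D[OF x(1), of "Suc n"] by simp
    qed
    then show ?thesis unfolding split by (simp only: F_def eq length_seg diff_Suc_1)
  qed
  define G where "G x = lim (F x)" for x
  have lim: "F x \<longlonglongrightarrow> G x" if x: "x \<in> SFT A" for x
  proof -
    have "(\<lambda>n. E * \<sigma> ^ n) \<longlonglongrightarrow> 0"
      using \<sigma> by (intro tendsto_mult_right_zero LIMSEQ_power_zero) auto
    have "Cauchy (F x)"
    proof (rule metric_CauchyI)
      fix e :: real assume "0 < e"
      then obtain n where n: "E * \<sigma> ^ n < e / 2"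
        using order_tendstoD(2)[OF \<open>(\<lambda>n. E * \<sigma> ^ n) \<longlonglongrightarrow> 0\<close>, of "e / 2"]
        by (auto simp: eventually_sequentially)
      have "dist (F x i) (F x j) < e" if "n \<le> i" "n \<le> j" for i j
        using close[OF x x _ that(1)] close[OF x x _ that(2)] n by (simp add: dist_real_def)
      then show "\<exists>n. \<forall>i\<ge>n. \<forall>j\<ge>n. dist (F x i) (F x j) < e" by blast
    qed
    then show ?thesis
      unfolding G_def by (simp add: Cauchy_convergent convergent_LIMSEQ_iff[symmetric])
  qed
  have Gclose: "\<bar>G x' - F x n\<bar> \<le> E * \<sigma> ^ n"
    if "x \<in> SFT A" "x' \<in> SFT A" "\<forall>i<n + 2. p (x i) = p (x' i)" for x x' n
  proof (rule LIMSEQ_le_const2)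
    show "(\<lambda>m. \<bar>F x' m - F x n\<bar>) \<longlonglongrightarrow> \<bar>G x' - F x n\<bar>"
      by (intro tendsto_intros lim that)
    show "\<exists>n'. \<forall>m\<ge>n'. \<bar>F x' m - F x n\<bar> \<le> E * \<sigma> ^ n"
      using close[OF that] by blast
  qed
  have "\<bar>G x - G x'\<bar> \<le> 2 * E * \<sigma> ^ n"
    if "x \<in> SFT A" "x' \<in> SFT A" "\<forall>i<n + 2. p (x i) = p (x' i)" for x x' n
    using Gclose[OF that] Gclose[OF that(1) that(1), of n] by simp
  moreover have "exp (- s) \<le> G x \<and> G x \<le> M" if "x \<in> SFT A" for x
    using LIMSEQ_le_const[OF lim[OF that]] LIMSEQ_le_const2[OF lim[OF that]] Fb[OF that] by blast
  ultimately show ?thesis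
    using E \<sigma> lim unfolding F_def
    by (intro exI[of _ G] exI[of _ "2 * E"] exI[of _ \<sigma>]) auto
qed

lemma seg_left_shift: "seg ((left_shift ^^ n) x) i j = seg x (n + i) (n + j)"
  by (rule nth_equalityI) (auto simp: seg_def left_shift_funpow add.assoc)

lemma Z_seg_pos: "x \<in> SFT A \<Longrightarrow> i \<le> m \<Longrightarrow> 0 < Z (seg x i m) (\<lambda>_. 1) ((left_shift ^^ m) x)"
  by (intro Z_pos[OF follows_seg left_shift_in_D]) auto

text \<open>Telescoping: the quotient is a product of \<open>n\<close> ratios of consecutive
  segments, all at the same base point far out on the orbit of \<open>x\<close>. The
  \<open>k\<close>-th factor tends to the exponential of \<open>\<psi>\<close> at the
  \<open>k\<close>-th shift.\<close>

lemma birkhoff_product: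
  assumes lim: "\<And>x. x \<in> SFT A \<Longrightarrow>
      (\<lambda>n. R (p (x 0)) (seg x 1 (Suc n)) ((left_shift ^^ Suc n) x)) \<longlonglongrightarrow> exp (\<psi> (block_map p x))"
    and x: "x \<in> SFT A"
  shows "(\<lambda>m. Z (seg x 0 m) (\<lambda>_. 1) ((left_shift ^^ m) x) / Z (seg x n m) (\<lambda>_. 1) ((left_shift ^^ m) x))
    \<longlonglongrightarrow> exp (\<Sum>k<n. \<psi> ((left_shift ^^ k) (block_map p x)))"
proof (induction n)
  case 0
  have "\<forall>\<^sub>F m in sequentially.
      Z (seg x 0 m) (\<lambda>_. 1) ((left_shift ^^ m) x) / Z (seg x 0 m) (\<lambda>_. 1) ((left_shift ^^ m) x) = 1"
    using Z_seg_pos[OF x, of 0] by (intro always_eventually allI) (simp add: less_le)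
  then show ?case by (simp add: tendsto_eventually)
next
  case (Suc n)
  let ?z = "\<lambda>i m. Z (seg x i m) (\<lambda>_. 1) ((left_shift ^^ m) x)"
  have "(\<lambda>j. ?z n (j + Suc n) / ?z (Suc n) (j + Suc n)) \<longlonglongrightarrow> exp (\<psi> ((left_shift ^^ n) (block_map p x)))"
  proof -
    have eq: "R (p ((left_shift ^^ n) x 0)) (seg ((left_shift ^^ n) x) 1 (Suc j)) ((left_shift ^^ Suc j) ((left_shift ^^ n) x))
        = ?z n (j + Suc n) / ?z (Suc n) (j + Suc n)" for j
    proof -
      have "(left_shift ^^ Suc j) ((left_shift ^^ n) x) = (left_shift ^^ (j + Suc n)) x"
        by (simp only: funpow_add[symmetric] comp_apply[symmetric, of "left_shift ^^ Suc j"]) simp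
      moreover have "p ((left_shift ^^ n) x 0) # seg ((left_shift ^^ n) x) 1 (Suc j) = seg x n (j + Suc n)"
        unfolding seg_left_shift by (simp add: left_shift_funpow seg_Cons[of n] add.commute)
      moreover have "seg ((left_shift ^^ n) x) 1 (Suc j) = seg x (Suc n) (j + Suc n)"
        unfolding seg_left_shift by (simp add: add.commute)
      ultimately show ?thesis by (simp only: R_def)
    qed
    have "block_map p ((left_shift ^^ n) x) = (left_shift ^^ n) (block_map p x)"
      by (simp add: block_map_def left_shift_funpow)
    with lim[OF SFT_left_shift[OF x, of n]] show ?thesis unfolding eq by simp
  qed
  then have "(\<lambda>m. ?z n m / ?z (Suc n) m) \<longlonglongrightarrow> exp (\<psi> ((left_shift ^^ n) (block_map p x)))"
    by (rule LIMSEQ_offset)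
  with Suc.IH have "(\<lambda>m. ?z 0 m / ?z n m * (?z n m / ?z (Suc n) m)) \<longlonglongrightarrow>
      exp (\<Sum>k<n. \<psi> ((left_shift ^^ k) (block_map p x))) * exp (\<psi> ((left_shift ^^ n) (block_map p x)))"
    by (rule tendsto_mult)
  then have "(\<lambda>m. ?z 0 m / ?z n m * (?z n m / ?z (Suc n) m)) \<longlonglongrightarrow>
      exp (\<Sum>k<Suc n. \<psi> ((left_shift ^^ k) (block_map p x)))"
    by (simp add: exp_add)
  moreover have "\<forall>\<^sub>F m in sequentially. ?z 0 m / ?z n m * (?z n m / ?z (Suc n) m) = ?z 0 m / ?z (Suc n) m"
    using eventually_ge_at_top[of n]
  proof eventually_elim
    case (elim m)
    with Z_seg_pos[OF x elim] show ?case by simp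
  qed
  ultimately show ?case by (rule Lim_transform_eventually)
qed

text \<open>For \<open>m \<ge> n\<close> the quotient in \<open>birkhoff_product\<close> is a
  weighted average of \<open>Z (seg x 0 n) (\<lambda>_. 1)\<close> over points over the image of
  \<open>x n\<close>. Bounds uniform over these points survive the limit.\<close>

lemma birkhoff_product_between:
  assumes lim: "\<And>x. x \<in> SFT A \<Longrightarrow>
      (\<lambda>n. R (p (x 0)) (seg x 1 (Suc n)) ((left_shift ^^ Suc n) x)) \<longlonglongrightarrow> exp (\<psi> (block_map p x))"
    and x: "x \<in> SFT A"
    and bd: "\<And>z. z \<in> D (p (x n)) \<Longrightarrow> lo \<le> Z (seg x 0 n) (\<lambda>_. 1) z \<and> Z (seg x 0 n) (\<lambda>_. 1) z \<le> hi"
  shows "lo \<le> exp (\<Sum>k<n. \<psi> ((left_shift ^^ k) (block_map p x)))"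
    "exp (\<Sum>k<n. \<psi> ((left_shift ^^ k) (block_map p x))) \<le> hi"
proof -
  let ?z = "\<lambda>i m. Z (seg x i m) (\<lambda>_. 1) ((left_shift ^^ m) x)"
  have *: "lo \<le> ?z 0 m / ?z n m \<and> ?z 0 m / ?z n m \<le> hi" if m: "n \<le> m" for m
  proof -
    have b: "lo \<le> Z [] (Z (seg x 0 n) (\<lambda>_. 1)) z / Z [] (\<lambda>_. 1) z
        \<and> Z [] (Z (seg x 0 n) (\<lambda>_. 1)) z / Z [] (\<lambda>_. 1) z \<le> hi"
      if "z \<in> D (hd (seg x n m @ [p (x m)]))" for z
      using that bd[of z] hd_seg[OF m, of x] by (auto simp: D_def Z_Nil)
    have "?z 0 m = Z (seg x n m) (Z (seg x 0 n) (\<lambda>_. 1)) ((left_shift ^^ m) x)"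
      using seg_append[of 0 n m x] m by (simp flip: Z_append)
    with ratio_between[of "[]" "seg x n m" "p (x m)" "(left_shift ^^ m) x" "\<lambda>_. 1", simplified,
        OF follows_seg[OF x m] left_shift_in_D[OF x] b]
    show ?thesis by simp
  qed
  show "lo \<le> exp (\<Sum>k<n. \<psi> ((left_shift ^^ k) (block_map p x)))"
    using * by (intro LIMSEQ_le_const[OF birkhoff_product[OF lim x]]) auto
  show "exp (\<Sum>k<n. \<psi> ((left_shift ^^ k) (block_map p x))) \<le> hi"
    using * by (intro LIMSEQ_le_const2[OF birkhoff_product[OF lim x]]) auto
qed

lemma holder_potential_exists:
  "\<exists>\<psi>. holder_potential (block_map p ` SFT A) \<psi> \<and>
    (\<forall>x\<in>SFT A. (\<lambda>n. R (p (x 0)) (seg x 1 (Suc n)) ((left_shift ^^ Suc n) x)) \<longlonglongrightarrow> exp (\<psi> (block_map p x)))"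
proof -
  obtain G E \<sigma> where E: "0 \<le> E" and \<sigma>: "0 < \<sigma>" "\<sigma> < 1"
    and G: "\<forall>x\<in>SFT A. (\<lambda>n. R (p (x 0)) (seg x 1 (Suc n)) ((left_shift ^^ Suc n) x)) \<longlonglongrightarrow> G x \<and>
       exp (- s) \<le> G x \<and> G x \<le> M"
    and Gd: "\<forall>x\<in>SFT A. \<forall>x'\<in>SFT A. \<forall>n. (\<forall>i<n + 2. p (x i) = p (x' i)) \<longrightarrow> \<bar>G x - G x'\<bar> \<le> E * \<sigma> ^ n"
    using ratio_limit by blast
  have lim: "(\<lambda>n. R (p (x 0)) (seg x 1 (Suc n)) ((left_shift ^^ Suc n) x)) \<longlonglongrightarrow> G x"
    and Gb: "exp (- s) \<le> G x \<and> G x \<le> M" if "x \<in> SFT A" for x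
    using bspec[OF G that] by blast+
  \<comment> \<open>Any choice of preimage will do, since \<open>G\<close> depends on the image only
    (\<open>G_lift\<close>).\<close>
  define lift where "lift y = (SOME x. x \<in> SFT A \<and> block_map p x = y)" for y
  define \<psi> where "\<psi> y = ln (G (lift y))" for y
  have lift: "lift y \<in> SFT A" "block_map p (lift y) = y" if "y \<in> block_map p ` SFT A" for y
    using that someI_ex[of "\<lambda>x. x \<in> SFT A \<and> block_map p x = y"] unfolding lift_def by auto
  have Gpos: "0 < G x" if "x \<in> SFT A" for x
    using Gb[OF that] exp_gt_zero less_le_trans by blast
  have G_lift: "G (lift (block_map p x)) = G x" if x: "x \<in> SFT A" for x
  proof -
    let ?x = "lift (block_map p x)"
    have l: "?x \<in> SFT A" "block_map p ?x = block_map p x" using lift x by auto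
    then have "p (?x i) = p (x i)" for i by (metis block_map_def)
    then have "\<bar>G ?x - G x\<bar> \<le> E * \<sigma> ^ n" for n using Gd l(1) x by blast
    moreover have "(\<lambda>n. E * \<sigma> ^ n) \<longlonglongrightarrow> 0"
      using \<sigma> by (intro tendsto_mult_right_zero LIMSEQ_power_zero) auto
    ultimately have "\<bar>G ?x - G x\<bar> \<le> 0"
      by (intro LIMSEQ_le_const[of "\<lambda>n. E * \<sigma> ^ n"]) auto
    then show ?thesis by simp
  qed
  \<comment> \<open>The logarithm has Lipschitz constant \<open>exp s\<close> on numbers at least
    \<open>exp (- s)\<close>, where \<open>G\<close> takes its values.\<close>
  have ln_diff: "ln a - ln b \<le> exp s * \<bar>a - b\<bar>" if "0 < a" "exp (- s) \<le> b" for a b :: real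
  proof -
    have b: "0 < b" using that(2) exp_gt_zero less_le_trans by blast
    then have "ln a - ln b = ln (a / b)" using that by (simp add: ln_div)
    also have "\<dots> \<le> a / b - 1" using that b by (intro ln_le_minus_one) simp
    also have "\<dots> = (a - b) * (1 / b)" using b by (simp add: field_simps)
    also have "\<dots> \<le> \<bar>a - b\<bar> * (1 / b)" using b by (intro mult_right_mono) auto
    also have "\<dots> \<le> \<bar>a - b\<bar> * exp s"
    proof (rule mult_left_mono)
      have "1 / b \<le> 1 / exp (- s)" using that(2) b by (intro divide_left_mono) auto
      then show "1 / b \<le> exp s" by (simp add: exp_minus field_simps)
    qed auto
    finally show ?thesis by (simp add: mult.commute)
  qed
  define C where "C = exp s * E / \<sigma>\<^sup>2 + exp s * M / \<sigma>"
  have C: "0 \<le> C" using E \<sigma> M_nonneg by (simp add: C_def)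
  have diff: "\<bar>\<psi> y - \<psi> y'\<bar> \<le> C * \<sigma> ^ n"
    if y: "y \<in> block_map p ` SFT A" "y' \<in> block_map p ` SFT A" and n: "1 \<le> n" and a: "\<forall>i<n. y i = y' i"
    for y y' n
  proof -
    let ?x = "lift y" and ?x' = "lift y'"
    have agree: "p (?x i) = p (?x' i)" if "i < n" for i
      using a that lift(2)[OF y(1)] lift(2)[OF y(2)] by (metis block_map_def)
    note X = lift(1)[OF y(1)] lift(1)[OF y(2)]
    have "\<bar>\<psi> y - \<psi> y'\<bar> \<le> exp s * \<bar>G ?x - G ?x'\<bar>"
      using ln_diff[of "G ?x" "G ?x'"] ln_diff[of "G ?x'" "G ?x"] X Gpos Gb
      by (auto simp: \<psi>_def abs_le_iff abs_minus_commute)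
    also have "\<dots> \<le> C * \<sigma> ^ n"
    proof (cases "n = 1")
      case True
      have "0 \<le> G ?x" "0 \<le> G ?x'" using X Gpos by (simp_all add: less_imp_le)
      then have "\<bar>G ?x - G ?x'\<bar> \<le> M" using Gb X by (smt (verit))
      then have "exp s * \<bar>G ?x - G ?x'\<bar> \<le> exp s * M / \<sigma> * \<sigma>" using \<sigma> by simp
      also have "\<dots> \<le> C * \<sigma>" using E \<sigma> by (intro mult_right_mono) (auto simp: C_def)
      finally show ?thesis using True by simp
    next
      case False
      define m where "m = n - 2"
      have m: "n = m + 2" using False n by (simp add: m_def)
      have "\<bar>G ?x - G ?x'\<bar> \<le> E * \<sigma> ^ m" using Gd X agree by (simp add: m)
      then have "exp s * \<bar>G ?x - G ?x'\<bar> \<le> exp s * (E * \<sigma> ^ m)" by simp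
      also have "\<dots> = exp s * E / \<sigma>\<^sup>2 * \<sigma> ^ n" using \<sigma> by (simp add: m power2_eq_square)
      also have "\<dots> \<le> C * \<sigma> ^ n" using M_nonneg \<sigma> by (intro mult_right_mono) (auto simp: C_def)
      finally show ?thesis .
    qed
    finally show ?thesis .
  qed
  have "variation (block_map p ` SFT A) \<psi> n \<le> ennreal (C * \<sigma> ^ n)" if "1 \<le> n" for n
    unfolding variation_def using diff[OF _ _ that] by (intro SUP_least) (auto intro!: ennreal_leI)
  then have "holder_potential (block_map p ` SFT A) \<psi>"
    unfolding holder_potential_def using C \<sigma> by blast
  moreover have "exp (\<psi> (block_map p x)) = G x" if "x \<in> SFT A" for x
    using Gpos[OF that] by (simp add: \<psi>_def G_lift[OF that])
  ultimately show ?thesis using lim by (intro exI[of _ \<psi>]) auto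
qed

subsection \<open>The Gibbs property\<close>

text \<open>For the second claim, the cylinders of the lifts are disjoint and lie in the preimage of
  the factor cylinder. For the first, that preimage is covered by cylinders of prefixes of length
  \<open>n + 1 - N\<close>, and each prefix is continued to a lift over \<open>z\<close>; the
  \<open>N - 1\<close> letters cut off cost at most
  \<open>exp ((\<bar>P\<bar> + s) * real N)\<close>.\<close>

lemma projected_cylinder_bounds:
  assumes inv: "invariant_prob_on (SFT A) \<mu>" and C: "1 \<le> C"
    and gibbs: "\<forall>x\<in>SFT A. \<forall>n\<ge>1. (let r = measure \<mu> (cylinder (SFT A) x n) /
        exp (- P * real n + (\<Sum>k<n. \<phi> ((left_shift ^^ k) x))) in inverse C \<le> r \<and> r \<le> C)"
    and x: "x \<in> SFT A" and n: "1 \<le> n" and z: "z \<in> D (p (x n))"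
  defines "m \<equiv> measure \<mu> {t \<in> SFT A. \<forall>i<n. p (t i) = p (x i)}"
    and "c \<equiv> C * exp ((\<bar>P\<bar> + s) * real N)"
  shows "exp (P * real n) * m / c \<le> Z (seg x 0 n) (\<lambda>_. 1) z"
    "Z (seg x 0 n) (\<lambda>_. 1) z \<le> c * (exp (P * real n) * m)"
proof -
  interpret \<mu>: prob_space \<mu> using inv by (simp add: invariant_prob_on_def)
  have sets: "sets \<mu> = sets (shift_borel (SFT A))" using inv by (simp add: invariant_prob_on_def)
  define cyl where "cyl a = {y \<in> SFT A. \<forall>i<length a. y i = a ! i}" for a
  have cyl_sets: "cyl a \<in> sets \<mu>" for a
  proof -
    have "cyl a = {y \<in> SFT A. \<forall>i<length a. y i \<in> {a ! i}}" by (auto simp: cyl_def)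
    then show ?thesis by (simp only: sets sets_shift_cylinder)
  qed
  have m_sets: "{t \<in> SFT A. \<forall>i<n. p (t i) = p (x i)} \<in> sets \<mu>"
  proof -
    have "{t \<in> SFT A. \<forall>i<n. p (t i) = p (x i)} = {t \<in> SFT A. \<forall>i<n. t i \<in> p -` {p (x i)}}" by auto
    then show ?thesis by (simp only: sets sets_shift_cylinder)
  qed
  note gw = gibbs_state_weight[OF _ _ gibbs C, folded cyl_def]
  have s0: "0 \<le> s" using s_nonneg x by blast
  have m0: "0 \<le> m" by (simp add: m_def)
  have fol: "follows (seg x 0 n) (p (x n))" using x by (intro follows_seg) auto
  have len: "length (seg x 0 n) = n" by (simp add: length_seg)
  have nth: "seg x 0 n ! i = p (x i)" if "i < n" for i using that by (simp add: seg_def)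
  have c1: "C \<le> c" using C s0 by (simp add: c_def)
  have Wlen: "length a = n" if "a \<in> W (seg x 0 n) z" for a
    using that len unfolding W_def by (metis (mono_tags, lifting) length_map mem_Collect_eq)
  have "Z (seg x 0 n) (\<lambda>_. 1) z \<le> (\<Sum>a\<in>W (seg x 0 n) z. C * exp (P * real n) * measure \<mu> (cyl a))"
    unfolding Z_def
  proof (rule sum_mono)
    fix a assume a: "a \<in> W (seg x 0 n) z"
    from Wlen[OF a] have "a \<noteq> []" using n by auto
    with gw(1)[of a z] a Wlen[OF a] show "exp (weight \<phi> a z) * 1 \<le> C * exp (P * real n) * measure \<mu> (cyl a)"
      by (simp add: W_def)
  qed
  also have "\<dots> = C * exp (P * real n) * (\<Sum>a\<in>W (seg x 0 n) z. measure \<mu> (cyl a))"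
    by (simp add: sum_distrib_left)
  also have "(\<Sum>a\<in>W (seg x 0 n) z. measure \<mu> (cyl a)) = measure \<mu> (\<Union>a\<in>W (seg x 0 n) z. cyl a)"
  proof (rule \<mu>.finite_measure_finite_Union[symmetric])
    show "disjoint_family_on cyl (W (seg x 0 n) z)"
      unfolding disjoint_family_on_def
    proof (intro ballI impI)
      fix a a' assume a: "a \<in> W (seg x 0 n) z" "a' \<in> W (seg x 0 n) z" "a \<noteq> a'"
      then obtain i where "i < n" "a ! i \<noteq> a' ! i"
        using Wlen nth_equalityI by metis
      then show "cyl a \<inter> cyl a' = {}" using Wlen a by (auto simp: cyl_def)
    qed
  qed (use cyl_sets finite_W in auto)
  also have "\<dots> \<le> m"
    unfolding m_def
  proof (rule \<mu>.finite_measure_mono[OF _ m_sets])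
    show "(\<Union>a\<in>W (seg x 0 n) z. cyl a) \<subseteq> {t \<in> SFT A. \<forall>i<n. p (t i) = p (x i)}"
    proof clarsimp
      fix a y assume a: "a \<in> W (seg x 0 n) z" "y \<in> cyl a"
      have "p (y i) = p (x i)" if "i < n" for i
        using a Wlen[OF a(1)] that nth[OF that] by (auto simp: cyl_def W_def dest!: arg_cong[of _ _ "\<lambda>l. l ! i"])
      with a show "y \<in> SFT A \<and> (\<forall>i<n. p (y i) = p (x i))" by (auto simp: cyl_def)
    qed
  qed
  finally have "Z (seg x 0 n) (\<lambda>_. 1) z \<le> C * exp (P * real n) * m"
    using C by simp
  also have "\<dots> \<le> c * (exp (P * real n) * m)"
    using c1 m0 by (simp add: mult.assoc mult_right_mono)
  finally show "Z (seg x 0 n) (\<lambda>_. 1) z \<le> c * (exp (P * real n) * m)" .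

  have "exp (P * real n) * m \<le> c * Z (seg x 0 n) (\<lambda>_. 1) z"
  proof (cases "n < N")
    case True
    \<comment> \<open>Too short for \<open>connect\<close>: the measure is at most 1, and a single
      lift bounds the sum from below.\<close>
    have "exp (P * real n) * m \<le> exp (P * real n)"
      by (simp add: m_def)
    also have "\<dots> \<le> exp (\<bar>P\<bar> * real n)" by (simp add: mult_right_mono)
    also have "\<dots> \<le> exp ((\<bar>P\<bar> + s) * real n) * Z (seg x 0 n) (\<lambda>_. 1) z"
      using Z_one_ge[OF fol z] len by (simp add: exp_minus exp_add field_simps distrib_right)
    also have "\<dots> \<le> c * Z (seg x 0 n) (\<lambda>_. 1) z"
    proof (rule mult_right_mono)
      have "exp ((\<bar>P\<bar> + s) * real n) \<le> exp ((\<bar>P\<bar> + s) * real N)"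
        using True s0 by (simp add: mult_left_mono)
      also have "\<dots> \<le> c" using C by (simp add: c_def)
      finally show "exp ((\<bar>P\<bar> + s) * real n) \<le> c" .
    qed (simp add: Z_def sum_nonneg)
    finally show ?thesis .
  next
    case False
    define l where "l = n + 1 - N"
    have l: "0 < l" "l \<le> n" "n - l + 1 = N" using False N0 n by (auto simp: l_def)
    have split: "seg x 0 l @ seg x l n = seg x 0 n" using l by (intro seg_append) auto
    define U where "U = {u. map p u = seg x 0 l \<and> (\<exists>y. prepend u y \<in> SFT A)}"
    have lenU: "length u = l" if "u \<in> U" for u
      using that length_seg[of x 0 l] by (auto simp: U_def dest: arg_cong[of _ _ length])
    have finU: "finite U"
      by (rule finite_subset[OF _ finite_words[of l]]) (use lenU in auto)
    have "\<exists>e. u @ e \<in> W (seg x 0 n) z" if u: "u \<in> U" for u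
    proof -
      obtain y where y: "prepend u y \<in> SFT A" using u by (auto simp: U_def)
      have mu: "map p u @ seg x l n = seg x 0 n" using u split by (simp add: U_def)
      have "u \<noteq> []" using lenU[OF u] l by auto
      then show ?thesis
        using connect[OF fol[folded mu] _ y _ z] l mu by (auto simp: length_seg)
    qed
    then obtain e where e: "u @ e u \<in> W (seg x 0 n) z" if "u \<in> U" for u
      by metis
    have cover: "{t \<in> SFT A. \<forall>i<n. p (t i) = p (x i)} \<subseteq> (\<Union>u\<in>U. cyl u)"
    proof
      fix t assume t: "t \<in> {t \<in> SFT A. \<forall>i<n. p (t i) = p (x i)}"
      have "prepend (map t [0..<l]) ((left_shift ^^ l) t) \<in> SFT A"
        using t by (simp add: prepend_map_left_shift)
      moreover have "map p (map t [0..<l]) = seg x 0 l"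
        using t l by (auto simp: seg_def)
      ultimately have "map t [0..<l] \<in> U" by (auto simp: U_def)
      moreover have "t \<in> cyl (map t [0..<l])" using t by (simp add: cyl_def)
      ultimately show "t \<in> (\<Union>u\<in>U. cyl u)" by blast
    qed
    have "m \<le> measure \<mu> (\<Union>u\<in>U. cyl u)"
      unfolding m_def using finU cyl_sets by (intro \<mu>.finite_measure_mono cover) auto
    also have "\<dots> \<le> (\<Sum>u\<in>U. measure \<mu> (cyl u))"
      using finU cyl_sets by (intro \<mu>.finite_measure_subadditive_finite) auto
    also have "\<dots> \<le> (\<Sum>u\<in>U. c * exp (- (P * real n)) * exp (weight \<phi> (u @ e u) z))"
    proof (rule sum_mono)
      fix u assume u: "u \<in> U"
      have X: "prepend u (prepend (e u) z) \<in> SFT A" using e[OF u] by (simp add: W_def prepend_append)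
      then have X': "prepend (e u) z \<in> SFT A" by (simp add: prepend_in_SFT_iff[of u])
      have le: "length (e u) = N - 1" using Wlen[OF e[OF u]] lenU[OF u] l by simp
      have we: "\<bar>weight \<phi> (e u) z\<bar> \<le> s * real (N - 1)" using weight_bound[OF X'] le by simp
      have "u \<noteq> []" using lenU[OF u] l by auto
      from gw(2)[OF X this] have "measure \<mu> (cyl u) \<le> C * exp (- (P * real l) + weight \<phi> u (prepend (e u) z))"
        by (simp only: exp_add mult.assoc lenU[OF u])
      moreover have "- (P * real l) + weight \<phi> u (prepend (e u) z)
        \<le> (\<bar>P\<bar> + s) * real N + - (P * real n) + weight \<phi> (u @ e u) z"
      proof -
        have n: "real n = real l + real (N - 1)" using l by simp
        have "P * real (N - 1) \<le> \<bar>P\<bar> * real (N - 1)" by (intro mult_right_mono) auto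
        also have "\<dots> \<le> \<bar>P\<bar> * real N" by (intro mult_left_mono) auto
        finally have "P * real (N - 1) \<le> \<bar>P\<bar> * real N" .
        moreover have "s * real (N - 1) \<le> s * real N" using s0 by (intro mult_left_mono) auto
        ultimately show ?thesis
          using we unfolding n weight_append by (simp add: algebra_simps abs_le_iff)
      qed
      ultimately have "measure \<mu> (cyl u) \<le> C * exp ((\<bar>P\<bar> + s) * real N + - (P * real n) + weight \<phi> (u @ e u) z)"
        using C by (smt (verit) exp_le_cancel_iff mult_left_mono)
      then show "measure \<mu> (cyl u) \<le> c * exp (- (P * real n)) * exp (weight \<phi> (u @ e u) z)"
        by (simp only: c_def exp_add mult_ac)
    qed
    also have "\<dots> = c * exp (- (P * real n)) * (\<Sum>u\<in>U. exp (weight \<phi> (u @ e u) z))"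
      by (simp add: sum_distrib_left)
    \<comment> \<open>Distinct prefixes of the common length \<open>l\<close> give distinct lifts,
      so this sum is part of the one defining \<open>Z\<close>.\<close>
    also have "(\<Sum>u\<in>U. exp (weight \<phi> (u @ e u) z)) = (\<Sum>a\<in>(\<lambda>u. u @ e u) ` U. exp (weight \<phi> a z))"
    proof (rule sum.reindex_cong[symmetric, OF _ refl])
      show "inj_on (\<lambda>u. u @ e u) U"
        by (intro inj_onI) (metis append_eq_append_conv lenU)
    qed simp
    also have "\<dots> \<le> Z (seg x 0 n) (\<lambda>_. 1) z"
      unfolding Z_def using e finite_W by (subst mult_1_right, intro sum_mono2) auto
    finally have "m \<le> c * exp (- (P * real n)) * Z (seg x 0 n) (\<lambda>_. 1) z"
      using C by (simp add: c_def)
    then show ?thesis by (simp add: exp_minus field_simps)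
  qed
  moreover have "0 < c" using C by (simp add: c_def)
  ultimately show "exp (P * real n) * m / c \<le> Z (seg x 0 n) (\<lambda>_. 1) z"
    by (simp add: field_simps)
qed

lemma projected_gibbs_state:
  assumes "gibbs_state (SFT A) \<phi> \<mu>"
  shows "\<exists>\<psi>. holder_potential (block_map p ` SFT A) \<psi> \<and>
    gibbs_state (block_map p ` SFT A) \<psi> (projected_measure p \<mu>)"
proof -
  obtain \<psi> where \<psi>: "holder_potential (block_map p ` SFT A) \<psi>"
    and lim: "\<And>x. x \<in> SFT A \<Longrightarrow> (\<lambda>n. R (p (x 0)) (seg x 1 (Suc n)) ((left_shift ^^ Suc n) x)) \<longlonglongrightarrow> exp (\<psi> (block_map p x))"
    using holder_potential_exists by blast
  obtain C P where inv: "invariant_prob_on (SFT A) \<mu>" and C: "1 \<le> C"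
    and gibbs: "\<forall>x\<in>SFT A. \<forall>n\<ge>1. (let r = measure \<mu> (cylinder (SFT A) x n) /
        exp (- P * real n + (\<Sum>k<n. \<phi> ((left_shift ^^ k) x))) in inverse C \<le> r \<and> r \<le> C)"
    using assms unfolding gibbs_state_def by blast
  interpret \<mu>: prob_space \<mu> using inv by (simp add: invariant_prob_on_def)
  have "SFT A \<noteq> {}"
    using \<mu>.not_empty inv by (simp add: invariant_prob_on_def)
  then have s0: "0 \<le> s" using s_nonneg by blast
  define c where "c = C * exp ((\<bar>P\<bar> + s) * real N)"
  have "1 * 1 \<le> C * exp ((\<bar>P\<bar> + s) * real N)"
    using C s0 by (intro mult_mono) auto
  then have c: "1 \<le> c" by (simp add: c_def)
  have "let r = measure (projected_measure p \<mu>) (cylinder (block_map p ` SFT A) (block_map p x) n) /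
      exp (- P * real n + (\<Sum>k<n. \<psi> ((left_shift ^^ k) (block_map p x)))) in inverse c \<le> r \<and> r \<le> c"
    if x: "x \<in> SFT A" and n: "1 \<le> n" for x n
  proof -
    let ?m = "measure \<mu> {t \<in> SFT A. \<forall>i<n. p (t i) = p (x i)}"
    let ?S = "\<Sum>k<n. \<psi> ((left_shift ^^ k) (block_map p x))"
    note bd = projected_cylinder_bounds[OF inv C gibbs x n, folded c_def]
    have "exp (P * real n) * ?m / c \<le> exp ?S" "exp ?S \<le> c * (exp (P * real n) * ?m)"
      using bd by (intro birkhoff_product_between[OF lim x]; blast)+
    then have "inverse c \<le> ?m / exp (- P * real n + ?S)" "?m / exp (- P * real n + ?S) \<le> c"
      using c by (simp_all add: exp_diff field_simps)
    then show ?thesis by (simp add: Let_def projected_measure_cylinder[OF inv])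
  qed
  then have "gibbs_state (block_map p ` SFT A) \<psi> (projected_measure p \<mu>)"
    unfolding gibbs_state_def using c invariant_projected_measure[OF inv, of p] by blast
  with \<psi> show ?thesis by blast
qed

end

section \<open>From the hypotheses to the locale\<close>

lemma variation_bound:
  assumes "variation X \<psi> n \<le> ennreal e" "0 \<le> e" "x \<in> X" "y \<in> X" "\<And>i. i < n \<Longrightarrow> x i = y i"
  shows "\<bar>\<psi> x - \<psi> y\<bar> \<le> e"
proof -
  have "ennreal \<bar>\<psi> x - \<psi> y\<bar> \<le> variation X \<psi> n"
    unfolding variation_def using assms(3-5) by (intro SUP_upper2[of "(x, y)"]) auto
  also note assms(1)
  finally show ?thesis using assms(2) by (simp add: ennreal_le_iff)
qed

text \<open>Mixing is applied to the whole space and the cylinder of the first symbol of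
  \<open>x\<close>. The hitting time can be taken positive, and the symbol just before it is the
  predecessor.\<close>

lemma mixing_SFT_predecessor:
  assumes mix: "topologically_mixing (SFT A)" and x: "x \<in> SFT A"
  shows "\<exists>a. prepend [a] x \<in> SFT A"
proof -
  let ?V = "{y \<in> SFT A. \<forall>i<1. y i \<in> {x i}}"
  have U: "openin (shift_topology (SFT A)) (SFT A)" "SFT A \<noteq> {}"
    using openin_shift_cylinder[of "SFT A" 0] x by auto
  have "openin (shift_topology (SFT A)) ?V" by (rule openin_shift_cylinder)
  moreover have "?V \<noteq> {}" using x by auto
  ultimately have "\<exists>n. \<forall>j\<ge>n. SFT A \<inter> (left_shift ^^ j) -` ?V \<noteq> {}"
    using U by (intro mix[unfolded topologically_mixing_def, rule_format] conjI)
  then obtain n where n: "\<forall>j\<ge>n. SFT A \<inter> (left_shift ^^ j) -` ?V \<noteq> {}" ..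
  from n[rule_format, of "Suc n"] obtain y where y: "y \<in> SFT A" "y (Suc n) = x 0"
    by (auto simp: left_shift_funpow simp del: funpow.simps)
  then have "A $ y n $ x 0 = 1" by (auto simp: SFT_def dest: spec[of _ n])
  then have "prepend [y n] x \<in> SFT A" using x by (simp add: prepend_in_SFT_iff del: prepend.simps)
  then show ?thesis by blast
qed

theorem theorem2:
  fixes A :: "nat ^ 'a::finite ^ 'a"
    and p :: "'a \<Rightarrow> 'b::finite"
    and \<phi> :: "(nat \<Rightarrow> 'a) \<Rightarrow> real"
    and \<mu> :: "(nat \<Rightarrow> 'a) measure"
  assumes "zero_one_matrix A"
    and "\<forall>a. admissible_word (SFT A) [a]"
    and "topologically_mixing (SFT A)"
    and "holder_potential (SFT A) \<phi>"
    and "gibbs_state (SFT A) \<phi> \<mu>"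
    and "fiberwise_mixing (SFT A) p"
  shows "\<exists>\<psi> :: (nat \<Rightarrow> 'b) \<Rightarrow> real.
           holder_potential (block_map p ` SFT A) \<psi> \<and>
           gibbs_state (block_map p ` SFT A) \<psi> (projected_measure p \<mu>)"
proof -
  obtain H \<theta> where H: "0 \<le> H" and \<theta>: "0 < \<theta>" "\<theta> < 1"
    and var: "\<And>n. 1 \<le> n \<Longrightarrow> variation (SFT A) \<phi> n \<le> ennreal (H * \<theta> ^ n)"
    using assms(4) unfolding holder_potential_def by blast
  have holder: "\<bar>\<phi> x - \<phi> x'\<bar> \<le> H * \<theta> ^ k"
    if "x \<in> SFT A" "x' \<in> SFT A" "0 < k" "\<And>i. i < k \<Longrightarrow> x i = x' i" for x x' k
    using that H \<theta> by (intro variation_bound[OF var]) auto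
  \<comment> \<open>The alphabet is finite, so one representative per first symbol bounds
    \<open>\<phi>\<close>: another point with the same first symbol differs by at most
    \<open>H * \<theta>\<close>, the bound on the first variation.\<close>
  define r where "r a = (SOME x. x \<in> SFT A \<and> x 0 = a)" for a
  define s where "s = (\<Sum>a\<in>UNIV. \<bar>\<phi> (r a)\<bar>) + H * \<theta>"
  have bounded: "\<bar>\<phi> x\<bar> \<le> s" if x: "x \<in> SFT A" for x
  proof -
    have r: "r (x 0) \<in> SFT A" "r (x 0) 0 = x 0"
      using someI[of "\<lambda>y. y \<in> SFT A \<and> y 0 = x 0" x] x unfolding r_def by auto
    have "\<bar>\<phi> x - \<phi> (r (x 0))\<bar> \<le> H * \<theta> ^ 1"
      using r by (intro holder x) auto
    moreover have "\<bar>\<phi> (r (x 0))\<bar> \<le> (\<Sum>a\<in>UNIV. \<bar>\<phi> (r a)\<bar>)"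
      by (rule member_le_sum) auto
    ultimately show ?thesis by (simp add: s_def)
  qed
  obtain N where N: "0 < N" and fiber: "\<And>b. length b = N + 1 \<and> admissible_word (block_map p ` SFT A) b \<Longrightarrow>
      \<forall>a a'. p a = b ! 0 \<and> p a' = b ! N \<longrightarrow>
        (\<exists>w. length w = N + 1 \<and> w ! 0 = a \<and> w ! N = a' \<and> admissible_word (SFT A) w \<and> map p w = b)"
    using assms(6) unfolding fiberwise_mixing_def by metis
  interpret fiber_mixing_system A p \<phi> s H \<theta> N
  proof
    show "\<exists>a. prepend [a] x \<in> SFT A" if "x \<in> SFT A" for x
      using mixing_SFT_predecessor[OF assms(3) that] .
  qed (use bounded holder H \<theta> N fiber in blast)+
  show ?thesis by (rule projected_gibbs_state[OF assms(5)])
qed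

end
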